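(* The set $\mathcal{R}\cup\mathcal{R}_{IV}$ does not generate $\mathcal{R}_V$.
   Context: An oriented singular tangle diagram in a disk is a generic immersion of finitely many oriented circles and properly immersed oriented arcs, whose only multiple points are transverse double points, each being either a real crossing (with over/under information) or a singular crossing (without over/under information). Diagrams are considered up to planar isotopy (fixing the boundary of the disk). A local move is a replacement, usable in both directions, of one diagram in a disk by another with the same oriented boundary points; it may be applied inside any embedded oriented disk (changing disk) of a larger diagram. Moves differing only by an orientation-preserving homeomorphism of the disk (and by exchanging the two sides) are the same move. Oriented moves: - Type I: an arc without crossing $\leftrightarrow$ an arc with one kink having a single real crossing (4 oriented moves, forming the set $\mathcal{R}_I$). - Type II: two disjoint arcs $\leftrightarrow$ two arcs meeting in two consecutive real crossings bounding a bigon, one arc passing over the other at both (4 oriented moves, forming $\mathcal{R}_{II}$). - Type III: three arcs pairwise crossing once at real crossings (a top, a middle and a bottom arc) bounding a triangle $\leftrightarrow$ the diagram after one arc is slid across the crossing of the other two (8 oriented moves, forming $\mathcal{R}_{III}$). - Type IV: two arcs meeting at one singular crossing, and a third arc crossing both of them at real crossings, passing over both or under both, on one side of the singular crossing $\leftrightarrow$ the same with the third arc slid across the singular crossing to the opposite side (8 oriented moves, forming $\mathcal{R}_{IV}$). - Type V: two arcs meeting in one singular crossing followed by one real crossing (the two crossings bounding a bigon) $\leftrightarrow$ the same with the order of the two crossings exchanged; i.e. as 2-strand tangles, $\tau\sigma^{\varepsilon}\leftrightarrow\sigma^{\varepsilon}\tau$, with $\tau$ the singular crossing, $\sigma^{\pm1}$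 the real crossings, and any orientations of the two strands (6 oriented moves, forming $\mathcal{R}_V$). Put $\mathcal{R}=\mathcal{R}_I\cup\mathcal{R}_{II}\cup\mathcal{R}_{III}$. A local move $m$ supported in a disk $B$ is generated by a set $S$ of local moves, written $m\prec S$, if the change prescribed by $m$ can be achieved by a finite sequence of moves from $S$ (and planar isotopies), all performed within $B$ and without affecting the diagram outside $B$. A set $S$ generates a set of moves $\mathcal{A}$ if $m\prec S$ for every $m\in\mathcal{A}$. *)

theory Defs
  imports "HOL-Analysis.Analysis"
begin

text \<open>
  Tangle diagrams live in the closed unit disk \<open>cball 0 1\<close> of the complex plane, in the \<open>C\<^sup>1\<close>
  category, which is the least regularity for which immersions and transversality make sense.
\<close>

definition wedge :: "complex \<Rightarrow> complex \<Rightarrow> real" where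
  "wedge v w = Re v * Im w - Im v * Re w"


section \<open>Generic immersions of arcs and circles\<close>

datatype strand = Arc (curve: "real \<Rightarrow> complex") | Circle (curve: "real \<Rightarrow> complex")

text \<open>
  \<open>C1_differentiable_on\<close> asks for two-sided derivatives, also at the end points of \<open>{0..1}\<close>; this is
  harmless, since the values of an arc outside \<open>{0..1}\<close> are irrelevant and a \<open>C\<^sup>1\<close> arc extends.
  The two inner products say that an arc enters and leaves the disk transversally.
\<close>

fun proper_strand :: "strand \<Rightarrow> bool" where
  "proper_strand (Arc \<gamma>) \<longleftrightarrow>
     \<gamma> C1_differentiable_on {0..1} \<and>
     (\<forall>t\<in>{0..1}. vector_derivative \<gamma> (at t) \<noteq> 0) \<and>
     \<gamma> 0 \<in> sphere 0 1 \<and> \<gamma> 1 \<in> sphere 0 1 \<and> \<gamma> ` {0<..<1} \<subseteq> ball 0 1 \<and>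
     \<gamma> 0 \<bullet> vector_derivative \<gamma> (at 0) < 0 \<and> \<gamma> 1 \<bullet> vector_derivative \<gamma> (at 1) > 0"
| "proper_strand (Circle \<gamma>) \<longleftrightarrow>
     \<gamma> C1_differentiable_on UNIV \<and>
     (\<forall>t. vector_derivative \<gamma> (at t) \<noteq> 0) \<and>
     (\<forall>t. \<gamma> (t + 1) = \<gamma> t) \<and> range \<gamma> \<subseteq> ball 0 1"

fun strand_dom :: "strand \<Rightarrow> real set" where
  "strand_dom (Arc \<gamma>) = {0..1}"
| "strand_dom (Circle \<gamma>) = {0..<1}"

text \<open>The source of the immersion: the disjoint union of the arcs and circles in the list.\<close>

definition params :: "strand list \<Rightarrow> (nat \<times> real) set" where
  "params cs = {(i, t). i < length cs \<and> t \<in> strand_dom (cs ! i)}"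

definition pos :: "strand list \<Rightarrow> nat \<times> real \<Rightarrow> complex" where
  "pos cs x = curve (cs ! fst x) (snd x)"

definition dir :: "strand list \<Rightarrow> nat \<times> real \<Rightarrow> complex" where
  "dir cs x = sgn (vector_derivative (curve (cs ! fst x)) (at (snd x)))"

definition generic_immersion :: "strand list \<Rightarrow> bool" where
  "generic_immersion cs \<longleftrightarrow>
     (\<forall>c\<in>set cs. proper_strand c) \<and>
     (\<forall>x\<in>params cs. \<forall>y\<in>params cs. x \<noteq> y \<and> pos cs x = pos cs y \<longrightarrow>
        pos cs x \<in> ball 0 1 \<and>
        wedge (dir cs x) (dir cs y) \<noteq> 0 \<and>
        (\<forall>z\<in>params cs. pos cs z = pos cs x \<longrightarrow> z = x \<or> z = y))"

definition unit_tangents :: "strand list \<Rightarrow> (complex \<times> complex) set" where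
  "unit_tangents cs = (\<lambda>x. (pos cs x, dir cs x)) ` params cs"


section \<open>Oriented singular tangle diagrams\<close>

text \<open>
  A generic immersion is recorded, independently of its parametrisation, by the set of all pairs
  (point, unit tangent vector at that point). As double points are transverse, the lift of the
  immersion to such pairs is injective, so that this set determines the oriented immersed curves up
  to orientation-preserving reparametrisation. A crossing is a point carrying two tangent vectors;
  \<open>over\<close> contains, for each real crossing, the point together with the tangent vector of the strand
  passing over.
\<close>

record diagram =
  tangents :: "(complex \<times> complex) set"
  singular :: "complex set"
  over :: "(complex \<times> complex) set"

definition crossings :: "diagram \<Rightarrow> complex set" where
  "crossings d = {p. \<exists>v w. v \<noteq> w \<and> (p, v) \<in> tangents d \<and> (p, w) \<in> tangents d}"

definition presents :: "strand list \<Rightarrow> diagram \<Rightarrow> bool" where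
  "presents cs d \<longleftrightarrow>
     generic_immersion cs \<and> tangents d = unit_tangents cs \<and>
     singular d \<subseteq> crossings d \<and>
     over d \<subseteq> tangents d \<and> fst ` over d = crossings d - singular d \<and> inj_on fst (over d)"

definition is_diagram :: "diagram \<Rightarrow> bool" where
  "is_diagram d \<longleftrightarrow> (\<exists>cs. presents cs d)"

text \<open>
  A positive crossing: the over strand is turned counterclockwise, by less than a half turn, to the
  under strand.
\<close>

definition positive_crossing :: "diagram \<Rightarrow> complex \<Rightarrow> bool" where
  "positive_crossing d p \<longleftrightarrow>
     (\<exists>v w. (p, v) \<in> over d \<and> (p, w) \<in> tangents d - over d \<and> wedge v w > 0)"


section \<open>Embedded disks and planar isotopy\<close>

text \<open>\<open>e' p\<close> is the derivative of \<open>e\<close> at \<open>p\<close>; its determinant is \<open>wedge (e' p 1) (e' p \<i>)\<close>.\<close>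

definition disk_embedding ::
    "(complex \<Rightarrow> complex) \<Rightarrow> (complex \<Rightarrow> complex \<Rightarrow>\<^sub>L complex) \<Rightarrow> bool" where
  "disk_embedding e e' \<longleftrightarrow>
     e ` cball 0 1 \<subseteq> cball 0 1 \<and> inj_on e (cball 0 1) \<and>
     (\<forall>p\<in>cball 0 1. (e has_derivative blinfun_apply (e' p)) (at p within cball 0 1)) \<and>
     continuous_on (cball 0 1) e' \<and>
     (\<forall>p\<in>cball 0 1. wedge (blinfun_apply (e' p) 1) (blinfun_apply (e' p) \<i>) > 0)"

definition push_tangent ::
    "(complex \<Rightarrow> complex) \<Rightarrow> (complex \<Rightarrow> complex \<Rightarrow>\<^sub>L complex) \<Rightarrow> complex \<times> complex \<Rightarrow> complex \<times> complex"
  where "push_tangent e e' x = (e (fst x), sgn (blinfun_apply (e' (fst x)) (snd x)))"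

definition push ::
    "(complex \<Rightarrow> complex) \<Rightarrow> (complex \<Rightarrow> complex \<Rightarrow>\<^sub>L complex) \<Rightarrow> diagram \<Rightarrow> diagram" where
  "push e e' d = \<lparr>tangents = push_tangent e e' ` tangents d,
                  singular = e ` singular d,
                  over = push_tangent e e' ` over d\<rparr>"

definition planar_isotopic :: "diagram \<Rightarrow> diagram \<Rightarrow> bool" where
  "planar_isotopic d d' \<longleftrightarrow>
     is_diagram d \<and> is_diagram d' \<and>
     (\<exists>h h'.
        (\<forall>s\<in>{0..1::real}. disk_embedding (h s) (h' s) \<and> h s ` cball 0 1 = cball 0 1 \<and>
                          (\<forall>p\<in>sphere 0 1. h s p = p)) \<and>
        continuous_on ({0..1} \<times> cball 0 1) (\<lambda>(s, p). h s p) \<and>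
        continuous_on ({0..1} \<times> cball 0 1) (\<lambda>(s, p). h' s p) \<and>
        (\<forall>p\<in>cball 0 1. h 0 p = p) \<and>
        d' = push (h 1) (h' 1) d)"


section \<open>Local moves and generation\<close>

text \<open>
  A local move is a pair of diagrams in the disk. It is applied inside the image of the disk under
  an orientation-preserving embedding. This accounts both for the choice of the changing disk and
  for the identification of moves that differ by an orientation-preserving homeomorphism.
\<close>

type_synonym local_move = "diagram \<times> diagram"

definition restrict_diagram :: "diagram \<Rightarrow> complex set \<Rightarrow> diagram" where
  "restrict_diagram d A = \<lparr>tangents = {x \<in> tangents d. fst x \<in> A},
                           singular = singular d \<inter> A,
                           over = {x \<in> over d. fst x \<in> A}\<rparr>"

definition apply_move :: "local_move \<Rightarrow> diagram \<Rightarrow> diagram \<Rightarrow> bool" where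
  "apply_move m d d' \<longleftrightarrow>
     is_diagram d \<and> is_diagram d' \<and>
     (\<exists>e e'. disk_embedding e e' \<and>
        restrict_diagram d (e ` cball 0 1) = push e e' (fst m) \<and>
        restrict_diagram d' (e ` cball 0 1) = push e e' (snd m) \<and>
        restrict_diagram d (- (e ` cball 0 1)) = restrict_diagram d' (- (e ` cball 0 1)))"

definition elementary_change :: "local_move set \<Rightarrow> diagram \<Rightarrow> diagram \<Rightarrow> bool" where
  "elementary_change S d d' \<longleftrightarrow>
     planar_isotopic d d' \<or> (\<exists>m\<in>S. apply_move m d d' \<or> apply_move m d' d)"

definition generated_by :: "local_move \<Rightarrow> local_move set \<Rightarrow> bool" (infix \<open>\<prec>\<^sub>m\<close> 50) where
  "m \<prec>\<^sub>m S \<longleftrightarrow> (elementary_change S)\<^sup>*\<^sup>* (fst m) (snd m)"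

definition generates :: "local_move set \<Rightarrow> local_move set \<Rightarrow> bool" where
  "generates S A \<longleftrightarrow> (\<forall>m\<in>A. m \<prec>\<^sub>m S)"


section \<open>The oriented moves\<close>

text \<open>
  Each set below contains all pairs of diagrams of the given shape. In every move the arcs of the two
  sides correspond to each other and have the same initial and terminal points.
\<close>

definition same_ends :: "(real \<Rightarrow> complex) \<Rightarrow> (real \<Rightarrow> complex) \<Rightarrow> bool" where
  "same_ends \<alpha> \<alpha>' \<longleftrightarrow> \<alpha> 0 = \<alpha>' 0 \<and> \<alpha> 1 = \<alpha>' 1"

abbreviation simple :: "(real \<Rightarrow> complex) \<Rightarrow> bool" where
  "simple \<alpha> \<equiv> inj_on \<alpha> {0..1}"

definition tangents_over :: "(real \<Rightarrow> complex) \<Rightarrow> complex set \<Rightarrow> (complex \<times> complex) set" where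
  "tangents_over \<alpha> P = {x \<in> unit_tangents [Arc \<alpha>]. fst x \<in> P}"

definition move_I :: "local_move set" where
  "move_I = {(m, m'). \<exists>\<alpha> \<alpha>'.
     presents [Arc \<alpha>] m \<and> presents [Arc \<alpha>'] m' \<and> same_ends \<alpha> \<alpha>' \<and>
     crossings m = {} \<and>
     is_singleton (crossings m') \<and> singular m' = {}}"

text \<open>
  In a disk, two simple arcs meeting in exactly two points, transversally, always bound a bigon
  whose interior is disjoint from both arcs; hence no separate condition is needed in types II and V.
\<close>

definition move_II :: "local_move set" where
  "move_II = {(m, m'). \<exists>\<alpha> \<beta> \<alpha>' \<beta>' p q.
     presents [Arc \<alpha>, Arc \<beta>] m \<and> presents [Arc \<alpha>', Arc \<beta>'] m' \<and>
     same_ends \<alpha> \<alpha>' \<and> same_ends \<beta> \<beta>' \<and>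
     crossings m = {} \<and>
     simple \<alpha>' \<and> simple \<beta>' \<and> path_image \<alpha>' \<inter> path_image \<beta>' = {p, q} \<and> p \<noteq> q \<and>
     singular m' = {} \<and> over m' = tangents_over \<alpha>' {p, q}}"

text \<open>
  Three simple arcs pairwise crossing once always bound a triangle. Sliding one of them across the
  crossing of the other two reverses, on each of the three arcs, the order of its two crossings.
\<close>

definition triangle :: "(real \<Rightarrow> complex) \<Rightarrow> (real \<Rightarrow> complex) \<Rightarrow> (real \<Rightarrow> complex) \<Rightarrow> bool" where
  "triangle \<alpha> \<beta> \<gamma> \<longleftrightarrow> simple \<alpha> \<and> simple \<beta> \<and> simple \<gamma> \<and>
     is_singleton (path_image \<alpha> \<inter> path_image \<beta>) \<and>
     is_singleton (path_image \<alpha> \<inter> path_image \<gamma>) \<and>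
     is_singleton (path_image \<beta> \<inter> path_image \<gamma>)"

text \<open>\<open>before \<alpha> P Q\<close>: the arc \<open>\<alpha>\<close> meets \<open>P\<close> before \<open>Q\<close>.\<close>

definition before :: "(real \<Rightarrow> complex) \<Rightarrow> complex set \<Rightarrow> complex set \<Rightarrow> bool" where
  "before \<alpha> P Q \<longleftrightarrow> (\<exists>s t. 0 \<le> s \<and> s < t \<and> t \<le> 1 \<and> \<alpha> s \<in> P \<and> \<alpha> t \<in> Q)"

definition slid ::
    "(real \<Rightarrow> complex) \<times> (real \<Rightarrow> complex) \<times> (real \<Rightarrow> complex) \<Rightarrow>
     (real \<Rightarrow> complex) \<times> (real \<Rightarrow> complex) \<times> (real \<Rightarrow> complex) \<Rightarrow> bool" where
  "slid = (\<lambda>(\<alpha>, \<beta>, \<gamma>) (\<alpha>', \<beta>', \<gamma>').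
     triangle \<alpha> \<beta> \<gamma> \<and> triangle \<alpha>' \<beta>' \<gamma>' \<and>
     same_ends \<alpha> \<alpha>' \<and> same_ends \<beta> \<beta>' \<and> same_ends \<gamma> \<gamma>' \<and>
     (before \<alpha> (path_image \<beta>) (path_image \<gamma>) \<longleftrightarrow> before \<alpha>' (path_image \<gamma>') (path_image \<beta>')) \<and>
     (before \<beta> (path_image \<alpha>) (path_image \<gamma>) \<longleftrightarrow> before \<beta>' (path_image \<gamma>') (path_image \<alpha>')) \<and>
     (before \<gamma> (path_image \<alpha>) (path_image \<beta>) \<longleftrightarrow> before \<gamma>' (path_image \<beta>') (path_image \<alpha>')))"

text \<open>The arcs \<open>\<alpha>\<close>, \<open>\<beta>\<close>, \<open>\<gamma>\<close> are the top, middle and bottom one.\<close>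

definition III_side ::
    "(real \<Rightarrow> complex) \<times> (real \<Rightarrow> complex) \<times> (real \<Rightarrow> complex) \<Rightarrow> diagram \<Rightarrow> bool" where
  "III_side = (\<lambda>(\<alpha>, \<beta>, \<gamma>) m.
     presents [Arc \<alpha>, Arc \<beta>, Arc \<gamma>] m \<and> singular m = {} \<and>
     over m = tangents_over \<alpha> (path_image \<beta> \<union> path_image \<gamma>) \<union> tangents_over \<beta> (path_image \<gamma>))"

definition move_III :: "local_move set" where
  "move_III = {(m, m'). \<exists>T T'. slid T T' \<and> III_side T m \<and> III_side T' m'}"

text \<open>
  The arcs \<open>\<alpha>\<close> and \<open>\<beta>\<close> meet at the singular crossing, and \<open>\<gamma>\<close> passes over both (if \<open>atop\<close> holds) or
  under both.
\<close>

definition IV_side ::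
    "bool \<Rightarrow> (real \<Rightarrow> complex) \<times> (real \<Rightarrow> complex) \<times> (real \<Rightarrow> complex) \<Rightarrow> diagram \<Rightarrow> bool" where
  "IV_side atop = (\<lambda>(\<alpha>, \<beta>, \<gamma>) m.
     presents [Arc \<alpha>, Arc \<beta>, Arc \<gamma>] m \<and> singular m = path_image \<alpha> \<inter> path_image \<beta> \<and>
     over m = (if atop then tangents_over \<gamma> (path_image \<alpha> \<union> path_image \<beta>)
               else tangents_over \<alpha> (path_image \<gamma>) \<union> tangents_over \<beta> (path_image \<gamma>)))"

definition move_IV :: "local_move set" where
  "move_IV = {(m, m'). \<exists>T T' atop. slid T T' \<and> IV_side atop T m \<and> IV_side atop T' m'}"

text \<open>
  Two arcs with one singular crossing \<open>p\<close> and one real crossing \<open>q\<close>. The exponent \<open>\<epsilon>\<close> of the real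
  crossing is the same on both sides of a type V move. As corresponding arcs have the same ends, and
  hence the same orientations as strands of the 2-strand tangle, this means that the real crossings
  on the two sides have the same sign.
\<close>

definition V_side ::
    "(real \<Rightarrow> complex) \<Rightarrow> (real \<Rightarrow> complex) \<Rightarrow> complex \<Rightarrow> complex \<Rightarrow> diagram \<Rightarrow> bool" where
  "V_side \<alpha> \<beta> p q m \<longleftrightarrow>
     presents [Arc \<alpha>, Arc \<beta>] m \<and> simple \<alpha> \<and> simple \<beta> \<and>
     path_image \<alpha> \<inter> path_image \<beta> = {p, q} \<and> p \<noteq> q \<and> singular m = {p}"

definition move_V :: "local_move set" where
  "move_V = {(m, m'). \<exists>\<alpha> \<beta> p q \<alpha>' \<beta>' p' q'.
     V_side \<alpha> \<beta> p q m \<and> V_side \<alpha>' \<beta>' p' q' m' \<and>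
     same_ends \<alpha> \<alpha>' \<and> same_ends \<beta> \<beta>' \<and>
     (before \<alpha> {p} {q} \<longleftrightarrow> before \<alpha>' {q'} {p'}) \<and>
     (before \<beta> {p} {q} \<longleftrightarrow> before \<beta>' {q'} {p'}) \<and>
     (positive_crossing m q \<longleftrightarrow> positive_crossing m' q')}"

definition classical_moves :: "local_move set" where
  "classical_moves = move_I \<union> move_II \<union> move_III"

end

theory Submission
  imports Defs
begin

text \<open>
  A move of type V trades a real crossing before the singular crossing for one of the same sign behind
  it. As the two crossings of the two strands bound a bigon, the equality of the signs forces the
  other strand to pass over: if the strand \<open>\<alpha>\<close> is the over strand on one side of the move, then \<open>\<beta>\<close>
  is on the other side. Hence the number of real crossings at which \<open>\<alpha>\<close> passes over \<open>\<beta>\<close> changes its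
  parity. The moves of types I to IV keep this parity: type I only affects self-crossings, type II
  adds or removes two crossings with the same over strand, and types III and IV keep, for each ordered
  pair of strands, the number of crossings at which the first passes over the second (in type IV
  because the singular crossing is not counted).

  To follow the strands through a sequence of moves it is not necessary to know them. Over the crossings,
  the two branches of a diagram \<open>d\<close> have different unit tangents; so the compact set \<open>tangents d\<close> of
  complex pairs is a disjoint union of embedded arcs and circles, and to colour whole strands with two
  colours means to split this set into two disjoint closed sets \<open>A\<close> and \<open>B\<close>. The invariant
  \<open>odd_splitting a b d\<close> asserts that some splitting, in which no strand of colour \<open>B\<close> ends at the
  boundary point \<open>a\<close> and no strand of colour \<open>A\<close> ends at the boundary point \<open>b\<close>, has an odd number of
  crossings where \<open>A\<close> passes over \<open>B\<close>. A diffeomorphism transports splittings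
  (\<open>odd_splitting_planar_isotopic\<close>). When the content of a disk is replaced, the colours of the old
  arcs in the disk are passed on to the new arcs with the same ends, and the result is again a pair of
  closed sets, because old and new arcs agree on the boundary of the disk
  (\<open>odd_splitting_replace_disk\<close>).

  For a diagram of two arcs which start at \<open>a\<close> and at \<open>b\<close>, the arcs are connected, so that only one
  splitting is possible. It is computed on both sides of an explicit type V move, given by a diameter
  and a parabola: on one side it has one crossing of the required kind, on the other side none.
\<close>

section \<open>Lifts of strands to unit tangent vectors\<close>

definition strand_lift :: "strand \<Rightarrow> (complex \<times> complex) set" where
  "strand_lift c = (\<lambda>t. (curve c t, sgn (vector_derivative (curve c) (at t)))) ` strand_dom c"

lemma unit_tangents_eq: "unit_tangents cs = (\<Union>i<length cs. strand_lift (cs ! i))"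
  by (force simp: unit_tangents_def params_def pos_def dir_def strand_lift_def)

lemma continuous_on_tangent_lift:
  assumes "\<gamma> C1_differentiable_on {0..1}" "\<forall>t\<in>{0..1}. vector_derivative \<gamma> (at t) \<noteq> 0"
  shows "continuous_on {0..1} (\<lambda>t. (\<gamma> t, sgn (vector_derivative \<gamma> (at t))))"
  using assms C1_differentiable_imp_continuous_on[OF assms(1)]
  by (intro continuous_on_Pair continuous_on_sgn) (simp_all add: C1_differentiable_on_eq)

lemma compact_connected_arc_lift:
  assumes "proper_strand (Arc \<gamma>)"
  shows "compact (strand_lift (Arc \<gamma>))" "connected (strand_lift (Arc \<gamma>))"
proof -
  have "continuous_on {0..1} (\<lambda>t. (\<gamma> t, sgn (vector_derivative \<gamma> (at t))))"
    using assms by (intro continuous_on_tangent_lift) auto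
  then show "compact (strand_lift (Arc \<gamma>))" "connected (strand_lift (Arc \<gamma>))"
    by (auto simp: strand_lift_def intro: compact_continuous_image connected_continuous_image)
qed

text \<open>
  The domain \<open>{0..<1}\<close> of a circle is not compact, but by periodicity the lift takes the same value at
  \<open>1\<close> as at \<open>0\<close>, so that it is also the image of \<open>{0..1}\<close>.
\<close>

lemma compact_circle_lift:
  assumes "proper_strand (Circle \<gamma>)"
  shows "compact (strand_lift (Circle \<gamma>))"
proof -
  let ?l = "\<lambda>t. (\<gamma> t, sgn (vector_derivative \<gamma> (at t)))"
  have per: "\<gamma> \<circ> (\<lambda>t. t + 1) = \<gamma>" using assms by (simp add: fun_eq_iff)
  have C1: "\<gamma> C1_differentiable_on UNIV" using assms by simp
  have "(\<gamma> has_vector_derivative vector_derivative \<gamma> (at 1)) (at 1)"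
    using C1 by (simp add: C1_differentiable_on_eq vector_derivative_works[symmetric])
  moreover have "((\<lambda>t. t + 1) has_vector_derivative 1) (at (0::real))"
    by (auto intro!: derivative_eq_intros)
  ultimately have "((\<gamma> \<circ> (\<lambda>t. t + 1)) has_vector_derivative 1 *\<^sub>R vector_derivative \<gamma> (at 1)) (at 0)"
    by (intro vector_diff_chain_at) simp_all
  then have "vector_derivative \<gamma> (at 0) = vector_derivative \<gamma> (at 1)"
    unfolding per by (simp add: vector_derivative_at)
  moreover have "\<gamma> 1 = \<gamma> 0" using fun_cong[OF per, of 0] by simp
  ultimately have "?l 1 \<in> ?l ` {0..<1}" by (intro image_eqI[of _ _ 0]) simp_all
  then have "?l ` {0..<1} = ?l ` (insert 1 {0..<1})" by auto
  also have "insert 1 {0..<1} = {0..1::real}" by auto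
  finally have "strand_lift (Circle \<gamma>) = ?l ` {0..1}" by (simp add: strand_lift_def)
  moreover have "continuous_on {0..1} ?l"
    using assms by (intro continuous_on_tangent_lift C1_differentiable_on_subset[OF C1]) auto
  ultimately show ?thesis by (simp add: compact_continuous_image)
qed

lemma compact_strand_lift: "proper_strand c \<Longrightarrow> compact (strand_lift c)"
  using compact_connected_arc_lift(1) compact_circle_lift by (cases c) blast+

lemma strand_lift_subset:
  assumes "proper_strand c"
  shows "strand_lift c \<subseteq> cball 0 1 \<times> sphere 0 1"
proof (cases c)
  case (Arc \<gamma>)
  have "\<gamma> t \<in> cball 0 1" if "t \<in> {0..1}" for t
  proof (cases "t \<in> {0<..<1}")
    case True
    then show ?thesis using assms Arc by force
  next
    case False
    then have "t = 0 \<or> t = 1" using that by auto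
    then show ?thesis using assms Arc by auto
  qed
  moreover have "\<forall>t\<in>{0..1}. vector_derivative \<gamma> (at t) \<noteq> 0" using assms Arc by simp
  ultimately show ?thesis using Arc by (auto simp: strand_lift_def norm_sgn)
next
  case (Circle \<gamma>)
  then have "range \<gamma> \<subseteq> ball 0 1" "\<forall>t. vector_derivative \<gamma> (at t) \<noteq> 0" using assms by auto
  then show ?thesis using Circle by (auto simp: strand_lift_def norm_sgn image_subset_iff less_imp_le)
qed

lemma diagram_tangents:
  assumes "is_diagram d"
  shows "compact (tangents d)" "tangents d \<subseteq> cball 0 1 \<times> sphere 0 1"
proof -
  obtain cs where cs: "generic_immersion cs" "tangents d = unit_tangents cs"
    using assms by (auto simp: is_diagram_def presents_def)
  then have "proper_strand (cs ! i)" if "i < length cs" for i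
    using that by (auto simp: generic_immersion_def)
  then show "compact (tangents d)" "tangents d \<subseteq> cball 0 1 \<times> sphere 0 1"
    using cs(2) strand_lift_subset by (fastforce simp: unit_tangents_eq intro!: compact_UN compact_strand_lift)+
qed

section \<open>Disk embeddings\<close>

lemma disk_embedding_derivative:
  assumes "disk_embedding e e'" "p \<in> cball 0 1" "blinfun_apply (e' p) v = 0"
  shows "v = 0"
proof -
  let ?L = "blinfun_apply (e' p)"
  have "v = Re v *\<^sub>R 1 + Im v *\<^sub>R \<i>" by (simp add: complex_eq_iff)
  then have "?L v = Re v *\<^sub>R ?L 1 + Im v *\<^sub>R ?L \<i>"
    by (metis blinfun.add_right blinfun.scaleR_right)
  then have 0: "Re v * Re (?L 1) + Im v * Re (?L \<i>) = 0" "Re v * Im (?L 1) + Im v * Im (?L \<i>) = 0"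
    using assms(3) by (auto simp: complex_eq_iff)
  have w: "wedge (?L 1) (?L \<i>) > 0" using assms by (auto simp: disk_embedding_def)
  have "Re v * wedge (?L 1) (?L \<i>) = 0" "Im v * wedge (?L 1) (?L \<i>) = 0"
    using 0 unfolding wedge_def by algebra+
  then show ?thesis using w by (simp add: complex_eq_iff)
qed

text \<open>
  The derivatives are invertible linear maps. Such a map sends different directions to different
  directions, although normalising the image vectors forgets their lengths.
\<close>

lemma inj_on_push_tangent:
  assumes "disk_embedding e e'"
  shows "inj_on (push_tangent e e') (cball 0 1 \<times> sphere 0 1)"
proof (rule inj_onI, clarify)
  fix p v q w :: complex
  assume A: "p \<in> cball 0 1" "v \<in> sphere 0 1" "q \<in> cball 0 1" "w \<in> sphere 0 1"
    "push_tangent e e' (p, v) = push_tangent e e' (q, w)"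
  have "e p = e q" using A by (simp add: push_tangent_def)
  then have pq: "p = q" using A assms by (auto simp: disk_embedding_def dest: inj_onD)
  let ?L = "blinfun_apply (e' p)"
  have nz: "?L v \<noteq> 0" "?L w \<noteq> 0"
    using disk_embedding_derivative[OF assms A(1)] A by force+
  have "sgn (?L v) = sgn (?L w)" using A pq by (simp add: push_tangent_def)
  then have "(norm (?L w) * norm (?L v)) *\<^sub>R sgn (?L v) = (norm (?L w) * norm (?L v)) *\<^sub>R sgn (?L w)"
    by simp
  moreover have "norm z *\<^sub>R sgn z = z" for z :: complex
    by (cases "z = 0") (simp_all add: sgn_div_norm)
  ultimately have "norm (?L w) *\<^sub>R ?L v = norm (?L v) *\<^sub>R ?L w"
    by (metis mult.commute scaleR_scaleR)
  then have "?L (norm (?L w) *\<^sub>R v - norm (?L v) *\<^sub>R w) = 0"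
    by (simp add: blinfun.diff_right blinfun.scaleR_right)
  then have eq: "norm (?L w) *\<^sub>R v = norm (?L v) *\<^sub>R w"
    using disk_embedding_derivative[OF assms A(1)] by (metis eq_iff_diff_eq_0)
  then have "norm (norm (?L w) *\<^sub>R v) = norm (norm (?L v) *\<^sub>R w)" by simp
  then have "norm (?L w) = norm (?L v)" using A by simp
  then have "v = w" using eq nz by simp
  with pq show "p = q \<and> v = w" by simp
qed

lemma continuous_on_push_tangent:
  assumes "disk_embedding e e'"
  shows "continuous_on (cball 0 1 \<times> sphere 0 1) (push_tangent e e')"
proof -
  have "continuous_on (cball 0 1) e"
    using assms by (auto simp: disk_embedding_def intro!: has_derivative_continuous_on)
  moreover have "continuous_on (cball 0 1) e'" using assms by (auto simp: disk_embedding_def)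
  moreover have "blinfun_apply (e' p) v \<noteq> 0" if "p \<in> cball 0 1" "v \<in> sphere 0 1" for p v
    using disk_embedding_derivative[OF assms that(1)] that(2) by force
  ultimately show ?thesis
    unfolding push_tangent_def
    by (fastforce intro!: continuous_intros intro: continuous_on_compose2[of "cball 0 1" _ _ fst])
qed

text \<open>
  By invariance of domain, the interior of the disk is mapped to an open set. Hence a changing disk can
  touch the rest of the diagram, and the outer boundary, only along the image of its own boundary.
\<close>

lemma disk_embedding_interior:
  assumes "disk_embedding e e'"
  shows "open (e ` ball 0 1)" "e ` ball 0 1 \<subseteq> ball 0 1"
proof -
  have "continuous_on (cball 0 1) e"
    using assms by (auto simp: disk_embedding_def intro!: has_derivative_continuous_on)
  then have "continuous_on (ball 0 1) e" "inj_on e (ball 0 1)"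
    using assms ball_subset_cball
    by (auto simp: disk_embedding_def intro: continuous_on_subset inj_on_subset)
  then show op: "open (e ` ball 0 1)" by (intro invariance_of_domain) auto
  have "e ` ball 0 1 \<subseteq> cball 0 1" using assms ball_subset_cball by (force simp: disk_embedding_def)
  then have "e ` ball 0 1 \<subseteq> interior (cball 0 1)" using op by (rule interior_maximal)
  then show "e ` ball 0 1 \<subseteq> ball 0 1" by simp
qed

section \<open>Counting crossings\<close>

text \<open>
  The crossings of \<open>d\<close> at which a strand in \<open>A\<close> passes over a strand in \<open>B\<close> are the triples in
  \<open>crossing_pairs (over d) A B\<close>. Recording both tangent vectors, and not only the point, makes these
  sets disjoint for different pairs of strands.
\<close>

definition crossing_pairs ::
    "(complex \<times> complex) set \<Rightarrow> (complex \<times> complex) set \<Rightarrow> (complex \<times> complex) set \<Rightarrow>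
     (complex \<times> complex \<times> complex) set" where
  "crossing_pairs O' A B = {(p, v, w). (p, v) \<in> O' \<and> (p, v) \<in> A \<and> (p, w) \<in> B}"

lemma crossing_pairs_push:
  assumes e: "disk_embedding e e'"
    and "O' \<subseteq> cball 0 1 \<times> sphere 0 1" "A \<subseteq> cball 0 1 \<times> sphere 0 1" "B \<subseteq> cball 0 1 \<times> sphere 0 1"
  defines "P \<equiv> push_tangent e e'"
  shows "bij_betw (\<lambda>(p, v, w). (e p, snd (P (p, v)), snd (P (p, w))))
           (crossing_pairs O' A B) (crossing_pairs (P ` O') (P ` A) (P ` B))"
    (is "bij_betw ?g ?X ?Y")
proof -
  have P: "P (p, v) = (e p, snd (P (p, v)))" for p v by (simp add: P_def push_tangent_def)
  have inj: "x = y" if "P x = P y" "x \<in> cball 0 1 \<times> sphere 0 1" "y \<in> cball 0 1 \<times> sphere 0 1" for x y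
    using inj_on_push_tangent[OF e] that by (auto simp: P_def dest: inj_onD)
  have "inj_on ?g ?X"
  proof (rule inj_onI)
    fix x y assume xy: "x \<in> ?X" "y \<in> ?X" "?g x = ?g y"
    obtain p v w p' v' w' where [simp]: "x = (p, v, w)" "y = (p', v', w')"
      using prod_cases3 by metis
    have "P (p, v) = P (p', v')" "P (p, w) = P (p', w')"
      using xy P[of p v] P[of p' v'] P[of p w] P[of p' w'] by auto
    moreover have "(p, v) \<in> A" "(p, w) \<in> B" "(p', v') \<in> A" "(p', w') \<in> B"
      using xy by (auto simp: crossing_pairs_def)
    ultimately have "(p, v) = (p', v')" "(p, w) = (p', w')"
      using inj assms(3,4) by blast+
    then show "x = y" by simp
  qed
  moreover have "?g ` ?X = ?Y"
  proof
    show "?g ` ?X \<subseteq> ?Y"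
      using P by (force simp: crossing_pairs_def)
    show "?Y \<subseteq> ?g ` ?X"
    proof
      fix y assume "y \<in> ?Y"
      then obtain x x1 x2 where x: "y = (fst (P x), snd (P x1), snd (P x2))" "x \<in> O'" "x1 \<in> A" "x2 \<in> B"
        "P x = P x1" "fst (P x) = fst (P x2)"
        by (auto simp: crossing_pairs_def image_iff) (metis fst_conv snd_conv)
      have "x = x1" using inj x assms(2,3) by blast
      moreover have "fst x = fst x2"
      proof -
        have "e (fst x) = e (fst x2)" using x by (simp add: P_def push_tangent_def)
        moreover have "fst x \<in> cball 0 1" "fst x2 \<in> cball 0 1" using x assms(2,4) by auto
        ultimately show ?thesis using e by (auto simp: disk_embedding_def dest: inj_onD)
      qed
      ultimately have "y = ?g (fst x1, snd x1, snd x2)" "(fst x1, snd x1, snd x2) \<in> ?X"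
        using x by (auto simp: crossing_pairs_def P_def push_tangent_def) (metis prod.collapse)+
      then show "y \<in> ?g ` ?X" by blast
    qed
  qed
  ultimately show ?thesis by (simp add: bij_betw_def)
qed

section \<open>Diagrams consisting of arcs\<close>

abbreviation arc_lift :: "(real \<Rightarrow> complex) \<Rightarrow> (complex \<times> complex) set" where
  "arc_lift \<alpha> \<equiv> strand_lift (Arc \<alpha>)"

lemma arc_lift_iff:
  "(p, v) \<in> arc_lift \<alpha> \<longleftrightarrow> (\<exists>t\<in>{0..1}. p = \<alpha> t \<and> v = sgn (vector_derivative \<alpha> (at t)))"
  by (auto simp: strand_lift_def)

lemma fst_arc_lift: "fst ` arc_lift \<alpha> = path_image \<alpha>"
  by (simp add: strand_lift_def path_image_def image_image)

lemma arc_lift_boundary: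
  assumes "proper_strand (Arc \<alpha>)" "(p, v) \<in> arc_lift \<alpha>" "p \<in> sphere 0 1"
  shows "p = \<alpha> 0 \<or> p = \<alpha> 1"
proof -
  obtain t where t: "t \<in> {0..1}" "p = \<alpha> t" using assms by (auto simp: arc_lift_iff)
  have "t \<notin> {0<..<1}"
  proof
    assume "t \<in> {0<..<1}"
    then have "\<alpha> t \<in> ball 0 1" using assms(1) by force
    then show False using t assms(3) by simp
  qed
  then have "t = 0 \<or> t = 1" using t by auto
  then show ?thesis using t by auto
qed

text \<open>
  Transversality makes the lifts of different arcs disjoint. Double points lie in the open disk, hence
  a boundary point belongs to at most one arc.
\<close>

lemma arc_diagram:
  assumes "presents (map Arc \<alpha>s) m"
  shows arc_diagram_proper: "\<And>i. i < length \<alpha>s \<Longrightarrow> proper_strand (Arc (\<alpha>s ! i))"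
    and arc_diagram_tangents: "tangents m = (\<Union>i<length \<alpha>s. arc_lift (\<alpha>s ! i))"
    and arc_diagram_disjoint: "\<And>i j. i < length \<alpha>s \<Longrightarrow> j < length \<alpha>s \<Longrightarrow> i \<noteq> j \<Longrightarrow>
      arc_lift (\<alpha>s ! i) \<inter> arc_lift (\<alpha>s ! j) = {}"
    and arc_diagram_boundary: "\<And>i j p v w. i < length \<alpha>s \<Longrightarrow> j < length \<alpha>s \<Longrightarrow>
      (p, v) \<in> arc_lift (\<alpha>s ! i) \<Longrightarrow> (p, w) \<in> arc_lift (\<alpha>s ! j) \<Longrightarrow> p \<in> sphere 0 1 \<Longrightarrow> i = j"
proof -
  have g: "generic_immersion (map Arc \<alpha>s)" and T: "tangents m = unit_tangents (map Arc \<alpha>s)"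
    using assms by (auto simp: presents_def)
  show "proper_strand (Arc (\<alpha>s ! i))" if "i < length \<alpha>s" for i
    using g that by (simp add: generic_immersion_def)
  show "tangents m = (\<Union>i<length \<alpha>s. arc_lift (\<alpha>s ! i))"
    unfolding T unit_tangents_eq by simp
  have X: "p \<in> ball 0 1 \<and> wedge v w \<noteq> 0"
    if ij: "i < length \<alpha>s" "j < length \<alpha>s" "i \<noteq> j"
      and pv: "(p, v) \<in> arc_lift (\<alpha>s ! i)" "(p, w) \<in> arc_lift (\<alpha>s ! j)" for i j p v w
  proof -
    obtain s t where st: "s \<in> {0..1}" "p = (\<alpha>s ! i) s" "v = sgn (vector_derivative (\<alpha>s ! i) (at s))"
      "t \<in> {0..1}" "p = (\<alpha>s ! j) t" "w = sgn (vector_derivative (\<alpha>s ! j) (at t))"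
      using pv by (auto simp: arc_lift_iff)
    have "(i, s) \<in> params (map Arc \<alpha>s)" "(j, t) \<in> params (map Arc \<alpha>s)"
      using ij st by (auto simp: params_def)
    moreover have "(i, s) \<noteq> (j, t)" "pos (map Arc \<alpha>s) (i, s) = pos (map Arc \<alpha>s) (j, t)"
      using ij st by (auto simp: pos_def)
    ultimately have "pos (map Arc \<alpha>s) (i, s) \<in> ball 0 1 \<and>
        wedge (dir (map Arc \<alpha>s) (i, s)) (dir (map Arc \<alpha>s) (j, t)) \<noteq> 0"
      using g unfolding generic_immersion_def by blast
    then show ?thesis using ij st by (simp add: pos_def dir_def)
  qed
  show "arc_lift (\<alpha>s ! i) \<inter> arc_lift (\<alpha>s ! j) = {}"
    if "i < length \<alpha>s" "j < length \<alpha>s" "i \<noteq> j" for i j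
    using X[OF that] by (fastforce simp: wedge_def)
  show "i = j" if "i < length \<alpha>s" "j < length \<alpha>s"
      "(p, v) \<in> arc_lift (\<alpha>s ! i)" "(p, w) \<in> arc_lift (\<alpha>s ! j)" "p \<in> sphere 0 1" for i j p v w
    using X[of i j p v w] that by force
qed

text \<open>
  This is all that the invariant has to know about a local move: the two sides consist of arcs with the
  same ends, and for any two different arcs the parity of the number of crossings at which the first
  passes over the second is the same on both sides.
\<close>

definition parity_equivalent :: "diagram \<Rightarrow> diagram \<Rightarrow> bool" where
  "parity_equivalent m m' \<longleftrightarrow> (\<exists>\<alpha>s \<alpha>s'.
     presents (map Arc \<alpha>s) m \<and> presents (map Arc \<alpha>s') m' \<and> length \<alpha>s = length \<alpha>s' \<and>
     (\<forall>i<length \<alpha>s. same_ends (\<alpha>s ! i) (\<alpha>s' ! i)) \<and>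
     (\<forall>i<length \<alpha>s. \<forall>j<length \<alpha>s. i \<noteq> j \<longrightarrow>
        finite (crossing_pairs (over m) (arc_lift (\<alpha>s ! i)) (arc_lift (\<alpha>s ! j))) \<and>
        finite (crossing_pairs (over m') (arc_lift (\<alpha>s' ! i)) (arc_lift (\<alpha>s' ! j))) \<and>
        (odd (card (crossing_pairs (over m) (arc_lift (\<alpha>s ! i)) (arc_lift (\<alpha>s ! j)))) \<longleftrightarrow>
         odd (card (crossing_pairs (over m') (arc_lift (\<alpha>s' ! i)) (arc_lift (\<alpha>s' ! j)))))))"

lemma parity_equivalent_sym: "parity_equivalent m m' \<Longrightarrow> parity_equivalent m' m"
  unfolding parity_equivalent_def same_ends_def by metis

text \<open>
  As the lifts of the arcs are disjoint, the crossings at which one family of arcs passes over another are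
  sorted by the two arcs involved. This reduces colourings to the pairwise counts of a local move.
\<close>

lemma card_crossing_pairs_UN:
  assumes m: "presents (map Arc \<alpha>s) m"
    and "c \<subseteq> {..<length \<alpha>s}" "c' \<subseteq> {..<length \<alpha>s}" "c \<inter> c' = {}"
    and fin: "\<And>i j. i \<in> c \<Longrightarrow> j \<in> c' \<Longrightarrow>
      finite (crossing_pairs (over m) (arc_lift (\<alpha>s ! i)) (arc_lift (\<alpha>s ! j)))"
  defines "X \<equiv> crossing_pairs (over m) (\<Union>i\<in>c. arc_lift (\<alpha>s ! i)) (\<Union>j\<in>c'. arc_lift (\<alpha>s ! j))"
  shows "finite X"
    and "card X = (\<Sum>(i, j)\<in>c \<times> c'.
      card (crossing_pairs (over m) (arc_lift (\<alpha>s ! i)) (arc_lift (\<alpha>s ! j))))"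
proof -
  let ?Y = "\<lambda>(i, j). crossing_pairs (over m) (arc_lift (\<alpha>s ! i)) (arc_lift (\<alpha>s ! j))"
  have X: "X = (\<Union>x\<in>c \<times> c'. ?Y x)"
    unfolding X_def by (auto simp: crossing_pairs_def)
  have cc: "finite (c \<times> c')" using assms by (auto intro: finite_subset)
  have fin': "finite (?Y x)" if "x \<in> c \<times> c'" for x using fin that by auto
  then show "finite X" unfolding X using cc by blast
  have "?Y (i, j) \<inter> ?Y (k, l) = {}"
    if "i \<in> c" "k \<in> c" "j \<in> c'" "l \<in> c'" "(i, j) \<noteq> (k, l)" for i j k l
  proof (rule ccontr)
    assume "?Y (i, j) \<inter> ?Y (k, l) \<noteq> {}"
    then obtain p v w where "(p, v) \<in> arc_lift (\<alpha>s ! i) \<inter> arc_lift (\<alpha>s ! k)"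
      "(p, w) \<in> arc_lift (\<alpha>s ! j) \<inter> arc_lift (\<alpha>s ! l)"
      by (auto simp: crossing_pairs_def)
    then have "i = k" "j = l" using arc_diagram_disjoint[OF m] that assms(2,3) by blast+
    then show False using that by simp
  qed
  then have "card X = (\<Sum>x\<in>c \<times> c'. card (?Y x))"
    unfolding X using cc fin' by (intro card_UN_disjoint) auto
  then show "card X = (\<Sum>(i, j)\<in>c \<times> c'.
      card (crossing_pairs (over m) (arc_lift (\<alpha>s ! i)) (arc_lift (\<alpha>s ! j))))"
    by (simp add: case_prod_unfold)
qed

section \<open>The invariant\<close>

text \<open>
  The sets \<open>A\<close> and \<open>B\<close> are unions of connected components of the lifted curves, that is, of whole strands.
  Oddness of \<open>card\<close> includes that the counted set is finite.
\<close>

definition odd_splitting :: "complex \<Rightarrow> complex \<Rightarrow> diagram \<Rightarrow> bool" where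
  "odd_splitting a b d \<longleftrightarrow> (\<exists>A B. closed A \<and> closed B \<and> A \<inter> B = {} \<and> tangents d = A \<union> B \<and>
     (\<forall>x\<in>B. fst x \<noteq> a) \<and> (\<forall>x\<in>A. fst x \<noteq> b) \<and> odd (card (crossing_pairs (over d) A B)))"


text \<open>
  Only the final diffeomorphism of the isotopy matters: it carries the two closed sets and the counted
  crossings along, and it fixes the boundary points \<open>a\<close> and \<open>b\<close>.
\<close>

lemma odd_splitting_planar_isotopic:
  assumes iso: "planar_isotopic d d'" and ab: "a \<in> sphere 0 1" "b \<in> sphere 0 1"
    and odd: "odd_splitting a b d"
  shows "odd_splitting a b d'"
proof -
  obtain A B where AB: "closed A" "closed B" "A \<inter> B = {}" "tangents d = A \<union> B"
      "\<forall>x\<in>B. fst x \<noteq> a" "\<forall>x\<in>A. fst x \<noteq> b" "odd (card (crossing_pairs (over d) A B))"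
    using odd unfolding odd_splitting_def by (elim exE conjE) (rule that)
  obtain h h' where h: "\<forall>s\<in>{0..1::real}. disk_embedding (h s) (h' s) \<and> h s ` cball 0 1 = cball 0 1 \<and>
      (\<forall>p\<in>sphere 0 1. h s p = p)" and dh: "d' = push (h 1) (h' 1) d"
    using iso unfolding planar_isotopic_def by (elim exE conjE) (rule that)
  define e where "e = h 1"
  define e' where "e' = h' 1"
  have "1 \<in> {0..1::real}" by simp
  then have e: "disk_embedding e e'" "\<And>p. p \<in> sphere 0 1 \<Longrightarrow> e p = p"
    using h unfolding e_def e'_def by blast+
  have d': "d' = push e e' d" using dh by (simp add: e_def e'_def)
  have d: "is_diagram d" using iso by (simp add: planar_isotopic_def)
  let ?P = "push_tangent e e'"
  have sub: "A \<subseteq> cball 0 1 \<times> sphere 0 1" "B \<subseteq> cball 0 1 \<times> sphere 0 1" "over d \<subseteq> cball 0 1 \<times> sphere 0 1"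
    using diagram_tangents(2)[OF d] AB(4) d by (auto simp: is_diagram_def presents_def)
  have cl: "closed (?P ` C)" if "closed C" "C \<subseteq> tangents d" for C
  proof -
    have "compact C" using that diagram_tangents(1)[OF d]
      by (metis compact_Int_closed inf.absorb_iff2)
    moreover have "C \<subseteq> cball 0 1 \<times> sphere 0 1" using that diagram_tangents(2)[OF d] by simp
    ultimately show ?thesis
      using continuous_on_push_tangent[OF e(1)]
      by (meson compact_continuous_image compact_imp_closed continuous_on_subset)
  qed
  have bd: "fst (?P x) \<noteq> q" if "fst x \<noteq> q" "q \<in> sphere 0 1" "x \<in> cball 0 1 \<times> sphere 0 1" for x q
  proof
    assume "fst (?P x) = q"
    then have "e (fst x) = e q" using e(2)[OF that(2)] by (simp add: push_tangent_def)
    then show False using that e(1) by (auto simp: disk_embedding_def dest!: inj_onD)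
  qed
  have "closed (?P ` A)" "closed (?P ` B)" using cl AB by auto
  moreover have "?P ` A \<inter> ?P ` B = {}"
    using inj_on_image_Int[OF inj_on_push_tangent[OF e(1)] sub(1,2)] AB(3) by auto
  moreover have "tangents d' = ?P ` A \<union> ?P ` B" using AB(4) by (auto simp: d' push_def)
  moreover have "\<forall>x\<in>?P ` B. fst x \<noteq> a" "\<forall>x\<in>?P ` A. fst x \<noteq> b"
    using bd ab AB(5,6) sub(1,2) by blast+
  moreover have "odd (card (crossing_pairs (over d') (?P ` A) (?P ` B)))"
    using bij_betw_same_card[OF crossing_pairs_push[OF e(1) sub(3,1,2)]] AB(7)
    by (simp add: d' push_def)
  ultimately show ?thesis unfolding odd_splitting_def by blast
qed

text \<open>
  Each old arc in the disk is connected and therefore lies in one of the two sets; the new arc with the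
  same ends receives its colour. The new sets are closed because a limit, inside the disk, of the unchanged
  part outside lies over a common end of an old and a new arc, which have the same colour. The crossings
  outside the disk are unchanged, and the parity of the number of those inside is a sum over the pairs of
  arcs of different colours.
\<close>

lemma odd_splitting_replace_disk:
  assumes m: "parity_equivalent m m'" and e: "disk_embedding e e'"
    and d: "is_diagram d" "is_diagram d'"
    and inside: "restrict_diagram d (e ` cball 0 1) = push e e' m"
      "restrict_diagram d' (e ` cball 0 1) = push e e' m'"
    and outside: "restrict_diagram d (- (e ` cball 0 1)) = restrict_diagram d' (- (e ` cball 0 1))"
    and ab: "a \<in> sphere 0 1" "b \<in> sphere 0 1"
    and odd: "odd_splitting a b d"
  shows "odd_splitting a b d'"
proof -
  obtain A B where AB: "closed A" "closed B" "A \<inter> B = {}" "tangents d = A \<union> B"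
      "\<forall>x\<in>B. fst x \<noteq> a" "\<forall>x\<in>A. fst x \<noteq> b" "odd (card (crossing_pairs (over d) A B))"
    using odd unfolding odd_splitting_def by (elim exE conjE) (rule that)
  obtain \<alpha>s \<alpha>s' where p: "presents (map Arc \<alpha>s) m" and p': "presents (map Arc \<alpha>s') m'"
      and len': "length \<alpha>s = length \<alpha>s'" and ends: "\<forall>i<length \<alpha>s. same_ends (\<alpha>s ! i) (\<alpha>s' ! i)"
      and par': "\<forall>i<length \<alpha>s. \<forall>j<length \<alpha>s. i \<noteq> j \<longrightarrow>
        finite (crossing_pairs (over m) (arc_lift (\<alpha>s ! i)) (arc_lift (\<alpha>s ! j))) \<and>
        finite (crossing_pairs (over m') (arc_lift (\<alpha>s' ! i)) (arc_lift (\<alpha>s' ! j))) \<and>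
        (odd (card (crossing_pairs (over m) (arc_lift (\<alpha>s ! i)) (arc_lift (\<alpha>s ! j)))) \<longleftrightarrow>
         odd (card (crossing_pairs (over m') (arc_lift (\<alpha>s' ! i)) (arc_lift (\<alpha>s' ! j)))))"
    using m unfolding parity_equivalent_def by (elim exE conjE) (rule that)
  note len = len'[symmetric]
  have fin: "finite (crossing_pairs (over m) (arc_lift (\<alpha>s ! i)) (arc_lift (\<alpha>s ! j)))"
        "finite (crossing_pairs (over m') (arc_lift (\<alpha>s' ! i)) (arc_lift (\<alpha>s' ! j)))"
    and par: "odd (card (crossing_pairs (over m) (arc_lift (\<alpha>s ! i)) (arc_lift (\<alpha>s ! j)))) \<longleftrightarrow>
         odd (card (crossing_pairs (over m') (arc_lift (\<alpha>s' ! i)) (arc_lift (\<alpha>s' ! j))))"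
    if "i < length \<alpha>s" "j < length \<alpha>s" "i \<noteq> j" for i j
    using par' that by blast+
  define n where "n = length \<alpha>s"
  define L where "L i = arc_lift (\<alpha>s ! i)" for i
  define L' where "L' i = arc_lift (\<alpha>s' ! i)" for i
  define P where "P = push_tangent e e'"
  define D where "D = e ` cball 0 1"
  let ?Z = "cball 0 1 \<times> sphere 0 1 :: (complex \<times> complex) set"
  have fstP: "fst (P x) = e (fst x)" for x by (simp add: P_def push_tangent_def)

  have tan_m: "tangents m = (\<Union>i<n. L i)" "tangents m' = (\<Union>i<n. L' i)"
    using arc_diagram_tangents[OF p] arc_diagram_tangents[OF p'] len by (auto simp: n_def L_def L'_def)
  have tan_in: "{x \<in> tangents d. fst x \<in> D} = P ` (\<Union>i<n. L i)"
      "{x \<in> tangents d'. fst x \<in> D} = P ` (\<Union>i<n. L' i)"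
    and over_in: "{x \<in> over d. fst x \<in> D} = P ` over m" "{x \<in> over d'. fst x \<in> D} = P ` over m'"
    using inside tan_m by (simp_all add: restrict_diagram_def push_def P_def D_def)
  have tan_out: "x \<in> tangents d \<longleftrightarrow> x \<in> tangents d'" and over_out: "x \<in> over d \<longleftrightarrow> x \<in> over d'"
    if "fst x \<notin> D" for x
    using outside that unfolding restrict_diagram_def D_def by auto

  have proper: "proper_strand (Arc (\<alpha>s ! i))" "proper_strand (Arc (\<alpha>s' ! i))" if "i < n" for i
    using arc_diagram_proper[OF p] arc_diagram_proper[OF p'] that len by (auto simp: n_def)
  have Z: "L i \<subseteq> ?Z" "L' i \<subseteq> ?Z" if "i < n" for i
    using strand_lift_subset proper[OF that] unfolding L_def L'_def by blast+
  have contP: "continuous_on ?Z P" and injP: "inj_on P ?Z"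
    using continuous_on_push_tangent[OF e] inj_on_push_tangent[OF e] by (simp_all add: P_def)
  have inje: "inj_on e (cball 0 1)" using e by (simp add: disk_embedding_def)
  have connPL: "connected (P ` L i)" if "i < n" for i
    using compact_connected_arc_lift(2)[OF proper(1)[OF that]] Z[OF that] contP
    by (metis L_def connected_continuous_image continuous_on_subset)
  have compPL': "compact (P ` L' i)" if "i < n" for i
    using compact_connected_arc_lift(1)[OF proper(2)[OF that]] Z[OF that] contP
    by (metis L'_def compact_continuous_image continuous_on_subset)
  have end': "\<exists>w. (q, w) \<in> L' i" and end'': "\<exists>w. (q, w) \<in> L i"
    if "i < n" and "(q, v) \<in> L i \<or> (q, v) \<in> L' i" and "q \<in> sphere 0 1" for i q v
  proof -
    have "same_ends (\<alpha>s ! i) (\<alpha>s' ! i)" using ends that by (simp add: n_def)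
    then have "q = (\<alpha>s ! i) 0 \<and> q = (\<alpha>s' ! i) 0 \<or> q = (\<alpha>s ! i) 1 \<and> q = (\<alpha>s' ! i) 1"
      using arc_lift_boundary[OF proper(1)[OF that(1)]] arc_lift_boundary[OF proper(2)[OF that(1)]] that(2,3)
      unfolding same_ends_def L_def L'_def by metis
    moreover have "0 \<in> {0..1::real}" "1 \<in> {0..1::real}" by auto
    ultimately show "\<exists>w. (q, w) \<in> L' i" "\<exists>w. (q, w) \<in> L i"
      unfolding L_def L'_def arc_lift_iff by blast+
  qed

  \<comment> \<open>Arcs are connected: those in the disk whose index is in \<open>c'\<close> lie entirely in \<open>B\<close>.\<close>
  define c where "c = {i. i < n \<and> P ` L i \<subseteq> A}"
  define c' where "c' = {..<n} - c"
  have PLT: "P ` L i \<subseteq> A \<union> B" if "i < n" for i using tan_in(1) AB(4) that by blast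
  have cA: "P ` L i \<subseteq> A" if "i \<in> c" for i using that by (simp add: c_def)
  have dich: "P ` L i \<subseteq> A \<or> P ` L i \<subseteq> B" if "i < n" for i
    using connPL[OF that] PLT[OF that] AB(1-3) unfolding connected_closed by blast
  have cB: "P ` L i \<subseteq> B" if "i \<in> c'" for i using dich that by (auto simp: c_def c'_def)
  have cAI: "i \<in> c" if "i < n" "P ` L i \<inter> A \<noteq> {}" for i
    using cB[of i] that AB(3) by (auto simp: c'_def)
  have cBI: "i \<in> c'" if "i < n" "P ` L i \<inter> B \<noteq> {}" for i
    using cA[of i] that AB(3) by (auto simp: c'_def)
  have cn: "c \<subseteq> {..<n}" "c' \<subseteq> {..<n}" "c \<inter> c' = {}" "c \<union> c' = {..<n}"
    by (auto simp: c_def c'_def)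

  \<comment> \<open>The new set of a colour: its old part outside the disk, and its new arcs inside.\<close>
  let ?new = "\<lambda>C k. {x \<in> C. fst x \<notin> D} \<union> P ` (\<Union>i\<in>k. L' i)"

  have cl: "closed (?new C k)"
    if C: "closed C" "C \<subseteq> tangents d" and k: "k \<subseteq> {..<n}"
      and kI: "\<And>i. i < n \<Longrightarrow> P ` L i \<inter> C \<noteq> {} \<Longrightarrow> i \<in> k" for C k
  proof -
    let ?O = "{x \<in> C. fst x \<notin> D}"
    have "closure ?O \<subseteq> ?new C k"
    proof
      fix x assume x: "x \<in> closure ?O"
      have "closure ?O \<subseteq> C" using C by (intro closure_minimal) auto
      moreover have "closure ?O \<subseteq> tangents d'"
        using C tan_out diagram_tangents(1)[OF d(2)]
        by (intro closure_minimal) (auto intro: compact_imp_closed)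
      moreover have "closure ?O \<subseteq> fst -` (- e ` ball 0 1)"
        using disk_embedding_interior(1)[OF e]
        by (intro closure_minimal closed_vimage_fst) (auto simp: D_def)
      ultimately have xC: "x \<in> C" "x \<in> tangents d'" "fst x \<notin> e ` ball 0 1" using x by auto
      show "x \<in> ?new C k"
      proof (cases "fst x \<in> D")
        case True
        then have "x \<in> P ` (\<Union>i<n. L i)" "x \<in> P ` (\<Union>i<n. L' i)"
          using xC C tan_in by blast+
        then obtain i y j y' where i: "i < n" "y \<in> L i" "x = P y" and j: "j < n" "y' \<in> L' j" "x = P y'"
          by blast
        \<comment> \<open>The limit point lies over an old arc \<open>i\<close> and over a new arc \<open>j\<close>. It comes from the boundary
          circle, where the new arc \<open>i\<close> ends as well and where no two arcs meet; so \<open>i = j\<close>.\<close>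
        have "e (fst y) = e (fst y')" using i j fstP by metis
        moreover have cb: "fst y \<in> cball 0 1" "fst y' \<in> cball 0 1"
          using i(2) j(2) Z[OF i(1)] Z[OF j(1)] by auto
        ultimately have yy: "fst y = fst y'" using inje by (auto dest: inj_onD)
        have "fst y \<notin> ball 0 1" using xC(3) i(3) fstP by blast
        then have sph: "fst y \<in> sphere 0 1" using cb by auto
        obtain w where "(fst y, w) \<in> L' i" using end'[OF i(1) _ sph] i(2) by (metis prod.collapse)
        moreover have "(fst y, snd y') \<in> L' j" using j(2) yy by simp
        ultimately have "i = j"
          using arc_diagram_boundary[OF p'] i(1) j(1) sph len unfolding L'_def n_def by metis
        moreover have "i \<in> k" using kI[OF i(1)] i xC by blast
        ultimately show ?thesis using j by blast
      qed (use xC in auto)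
    qed
    moreover have "closed (P ` (\<Union>i\<in>k. L' i))"
      using compPL' k finite_subset[OF k] by (auto simp: image_UN intro!: compact_imp_closed compact_UN)
    ultimately have "closure (?new C k) \<subseteq> ?new C k"
      unfolding closure_Un by (simp add: closure_closed)
    then show ?thesis by (simp only: closure_subset_eq)
  qed

  have bd: "\<forall>x\<in>?new C k. fst x \<noteq> q"
    if C: "\<forall>x\<in>C. fst x \<noteq> q" and q: "q \<in> sphere 0 1" and k: "k \<subseteq> {..<n}" "\<And>i. i \<in> k \<Longrightarrow> P ` L i \<subseteq> C"
    for C k q
  proof
    fix x assume x: "x \<in> ?new C k"
    show "fst x \<noteq> q"
    proof
      assume xq: "fst x = q"
      then obtain i y where y: "i \<in> k" "y \<in> L' i" "x = P y" using x C by auto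
      have i: "i < n" using y k by auto
      have "e (fst y) \<notin> ball 0 1" using xq y q fstP by auto
      then have "fst y \<notin> ball 0 1" using disk_embedding_interior(2)[OF e] by blast
      moreover have "fst y \<in> cball 0 1" using y Z[OF i] by auto
      ultimately have "fst y \<in> sphere 0 1" by auto
      then obtain w where "(fst y, w) \<in> L i" using end''[OF i] y by (metis prod.collapse)
      then have "P (fst y, w) \<in> C" using k(2) y by blast
      moreover have "fst (P (fst y, w)) = q" using xq y fstP by (metis fst_conv)
      ultimately show False using C by blast
    qed
  qed

  define F where "F = P ` (\<Union>i\<in>c. L i)"
  define G where "G = P ` (\<Union>i\<in>c'. L i)"
  define F' where "F' = P ` (\<Union>i\<in>c. L' i)"
  define G' where "G' = P ` (\<Union>i\<in>c'. L' i)"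
  define A' where "A' = {x \<in> A. fst x \<notin> D} \<union> F'"
  define B' where "B' = {x \<in> B. fst x \<notin> D} \<union> G'"
  have FG: "F \<union> G = {x \<in> tangents d. fst x \<in> D}"
    unfolding tan_in(1) F_def G_def image_Un[symmetric] UN_Un[symmetric] cn(4) ..
  have FG': "F' \<union> G' = {x \<in> tangents d'. fst x \<in> D}"
    unfolding tan_in(2) F'_def G'_def image_Un[symmetric] UN_Un[symmetric] cn(4) ..
  have FG'0: "F' \<inter> G' = {}"
  proof -
    have "L' i \<inter> L' j = {}" if "i \<in> c" "j \<in> c'" for i j
      unfolding L'_def using that cn len
      by (intro arc_diagram_disjoint[OF p']) (auto simp: n_def)
    then have "(\<Union>i\<in>c. L' i) \<inter> (\<Union>i\<in>c'. L' i) = {}" by blast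
    moreover have "(\<Union>i\<in>c. L' i) \<subseteq> ?Z" "(\<Union>i\<in>c'. L' i) \<subseteq> ?Z" using Z(2) cn(1,2) by blast+
    ultimately show ?thesis
      unfolding F'_def G'_def using inj_on_image_Int[OF injP] by (metis image_empty)
  qed
  have "F \<subseteq> A" "G \<subseteq> B" using cA cB unfolding F_def G_def image_UN by (simp_all add: UN_subset_iff)
  have FA: "x \<in> A \<longleftrightarrow> x \<in> F" and GB: "x \<in> B \<longleftrightarrow> x \<in> G" if "fst x \<in> D" for x
    using that FG \<open>F \<subseteq> A\<close> \<open>G \<subseteq> B\<close> AB(3,4) by blast+
  have FD: "fst x \<in> D" if "x \<in> F \<or> x \<in> G" for x using FG that by blast
  have FD': "fst x \<in> D" if "x \<in> F' \<or> x \<in> G'" for x using FG' that by blast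

  have "A \<subseteq> tangents d" "B \<subseteq> tangents d" using AB(4) by simp_all
  then have "closed A'" "closed B'"
    using cl[OF AB(1) _ cn(1) cAI] cl[OF AB(2) _ cn(2) cBI]
    unfolding A'_def B'_def F'_def G'_def by blast+
  moreover have "A' \<inter> B' = {}"
    unfolding A'_def B'_def using AB(3) FG'0 FD' by blast
  moreover have "tangents d' = A' \<union> B'"
  proof -
    have "A' \<union> B' = {x \<in> A \<union> B. fst x \<notin> D} \<union> (F' \<union> G')"
      unfolding A'_def B'_def by blast
    also have "\<dots> = {x \<in> tangents d'. fst x \<notin> D} \<union> {x \<in> tangents d'. fst x \<in> D}"
      unfolding FG' AB(4)[symmetric] using tan_out by blast
    finally show ?thesis by blast
  qed
  moreover have "\<forall>x\<in>B'. fst x \<noteq> a"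
    using bd[OF AB(5) ab(1) cn(2) cB] unfolding B'_def G'_def .
  moreover have "\<forall>x\<in>A'. fst x \<noteq> b"
    using bd[OF AB(6) ab(2) cn(1) cA] unfolding A'_def F'_def .
  moreover have "odd (card (crossing_pairs (over d') A' B'))"
  proof -
    let ?K = "\<lambda>k. \<Union>i\<in>k. L i" and ?K' = "\<lambda>k. \<Union>i\<in>k. L' i"
    let ?C = "crossing_pairs (over d) A B" and ?C' = "crossing_pairs (over d') A' B'"
    have out: "{x \<in> ?C'. fst x \<notin> D} = {x \<in> ?C. fst x \<notin> D}"
    proof -
      have "(p, v) \<in> A' \<longleftrightarrow> (p, v) \<in> A" "(p, v) \<in> B' \<longleftrightarrow> (p, v) \<in> B"
        "(p, v) \<in> over d' \<longleftrightarrow> (p, v) \<in> over d" if "p \<notin> D" for p v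
        using that FD'[of "(p, v)"] over_out[of "(p, v)"] by (auto simp: A'_def B'_def)
      then show ?thesis by (auto simp: crossing_pairs_def)
    qed
    have C_in: "{x \<in> ?C. fst x \<in> D} = crossing_pairs (P ` over m) F G"
    proof -
      have "(p, v) \<in> A \<longleftrightarrow> (p, v) \<in> F" "(p, v) \<in> B \<longleftrightarrow> (p, v) \<in> G"
        "(p, v) \<in> over d \<longleftrightarrow> (p, v) \<in> P ` over m" if "p \<in> D" for p v
        using that FA[of "(p, v)"] GB[of "(p, v)"] over_in(1)[symmetric] by auto
      moreover have "p \<in> D" if "(p, v) \<in> F" for p v using FD[of "(p, v)"] that by simp
      ultimately show ?thesis by (auto simp: crossing_pairs_def simp del: image_iff del: imageE)
    qed
    have C'_in: "{x \<in> ?C'. fst x \<in> D} = crossing_pairs (P ` over m') F' G'"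
    proof -
      have "(p, v) \<in> A' \<longleftrightarrow> (p, v) \<in> F'" "(p, v) \<in> B' \<longleftrightarrow> (p, v) \<in> G'"
        "(p, v) \<in> over d' \<longleftrightarrow> (p, v) \<in> P ` over m'" if "p \<in> D" for p v
        using that over_in(2)[symmetric] by (auto simp: A'_def B'_def)
      moreover have "p \<in> D" if "(p, v) \<in> F'" for p v using FD'[of "(p, v)"] that by simp
      ultimately show ?thesis by (auto simp: crossing_pairs_def simp del: image_iff del: imageE)
    qed
    have Zs: "over m \<subseteq> ?Z" "over m' \<subseteq> ?Z" "?K c \<subseteq> ?Z" "?K c' \<subseteq> ?Z" "?K' c \<subseteq> ?Z" "?K' c' \<subseteq> ?Z"
    proof -
      have "over m \<subseteq> tangents m" "over m' \<subseteq> tangents m'" using p p' unfolding presents_def by blast+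
      moreover have "?K {..<n} \<subseteq> ?Z" "?K' {..<n} \<subseteq> ?Z" using Z by blast+
      ultimately show "over m \<subseteq> ?Z" "over m' \<subseteq> ?Z" unfolding tan_m by (meson order_trans)+
      show "?K c \<subseteq> ?Z" "?K c' \<subseteq> ?Z" "?K' c \<subseteq> ?Z" "?K' c' \<subseteq> ?Z" using Z cn(1,2) by blast+
    qed
    note I = crossing_pairs_push[OF e Zs(1,3,4), folded P_def, folded F_def G_def, folded C_in]
    note I' = crossing_pairs_push[OF e Zs(2,5,6), folded P_def, folded F'_def G'_def, folded C'_in]
    have ij: "i < length \<alpha>s" "j < length \<alpha>s" "i \<noteq> j" if "i \<in> c" "j \<in> c'" for i j
      using that cn by (auto simp: n_def)
    have cs: "c \<subseteq> {..<length \<alpha>s}" "c' \<subseteq> {..<length \<alpha>s}" "c \<subseteq> {..<length \<alpha>s'}" "c' \<subseteq> {..<length \<alpha>s'}"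
      using cn(1,2) len by (simp_all add: n_def)
    note N = card_crossing_pairs_UN[OF p cs(1,2) cn(3) fin(1)[OF ij], folded L_def]
    note N' = card_crossing_pairs_UN[OF p' cs(3,4) cn(3) fin(2)[OF ij], folded L'_def]
    have "finite (c \<times> c')" using cn by (auto intro: finite_subset)
    moreover have "{x \<in> c \<times> c'. odd (case x of (i, j) \<Rightarrow> card (crossing_pairs (over m) (L i) (L j)))} =
        {x \<in> c \<times> c'. odd (case x of (i, j) \<Rightarrow> card (crossing_pairs (over m') (L' i) (L' j)))}"
      using par ij unfolding L_def L'_def by auto
    ultimately have "odd (card (crossing_pairs (over m) (?K c) (?K c')))
        \<longleftrightarrow> odd (card (crossing_pairs (over m') (?K' c) (?K' c')))"
      by (simp add: N(2) N'(2) even_sum_iff)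
    then have parity: "odd (card {x \<in> ?C. fst x \<in> D}) \<longleftrightarrow> odd (card {x \<in> ?C'. fst x \<in> D})"
      using bij_betw_same_card[OF I] bij_betw_same_card[OF I'] by simp
    have fin_in: "finite {x \<in> ?C. fst x \<in> D}" "finite {x \<in> ?C'. fst x \<in> D}"
      using bij_betw_finite[OF I] bij_betw_finite[OF I'] N(1) N'(1) by simp_all
    have split: "card X = card {x \<in> X. fst x \<notin> D} + card {x \<in> X. fst x \<in> D}"
      if "finite {x \<in> X. fst x \<notin> D}" "finite {x \<in> X. fst x \<in> D}"
      for X :: "(complex \<times> complex \<times> complex) set"
      using that by (subst card_Un_disjoint[symmetric]) (auto intro!: arg_cong[of _ _ card])
    \<comment> \<open>The set is finite because infinite sets have the even cardinality \<open>0\<close>.\<close>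
    have "finite ?C" using AB(7) by (metis card.infinite even_zero)
    then have "finite {x \<in> ?C. fst x \<notin> D}" by simp
    then show ?thesis
      using split[of ?C] split[of ?C'] fin_in parity AB(7) unfolding out by simp
  qed
  ultimately show ?thesis unfolding odd_splitting_def by blast
qed

section \<open>The moves of types I to IV\<close>

lemma tangents_over_eq: "tangents_over \<alpha> P = {x \<in> arc_lift \<alpha>. fst x \<in> P}"
  by (simp add: tangents_over_def unit_tangents_eq lessThan_Suc)

lemma inj_on_fst_arc_lift:
  assumes "simple \<alpha>"
  shows "inj_on fst (arc_lift \<alpha>)"
  using assms by (auto simp: inj_on_def strand_lift_def)

text \<open>
  A crossing has only one upper strand. Therefore, if the arc \<open>i\<close> is the upper one wherever it meets the
  arc \<open>j\<close>, all common points count for the pair \<open>(i, j)\<close> and none for the pair \<open>(j, i)\<close>.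
\<close>

lemma crossings_over:
  assumes m: "presents (map Arc \<alpha>s) m" and ij: "i < length \<alpha>s" "j < length \<alpha>s" "i \<noteq> j"
    and simple: "simple (\<alpha>s ! i)" "simple (\<alpha>s ! j)"
    and fin: "finite (path_image (\<alpha>s ! i) \<inter> path_image (\<alpha>s ! j))"
    and over: "tangents_over (\<alpha>s ! i) (path_image (\<alpha>s ! j)) \<subseteq> over m"
  defines "X \<equiv> \<lambda>i j. crossing_pairs (over m) (arc_lift (\<alpha>s ! i)) (arc_lift (\<alpha>s ! j))"
  shows "finite (X i j)" "card (X i j) = card (path_image (\<alpha>s ! i) \<inter> path_image (\<alpha>s ! j))" "X j i = {}"
proof -
  have path: "p \<in> path_image (\<alpha>s ! k) \<longleftrightarrow> (\<exists>v. (p, v) \<in> arc_lift (\<alpha>s ! k))" for p k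
    by (force simp: fst_arc_lift[symmetric])
  have ov: "(p, v) \<in> over m" if "(p, v) \<in> arc_lift (\<alpha>s ! i)" "(p, w) \<in> arc_lift (\<alpha>s ! j)" for p v w
    using over that path[of p j] unfolding tangents_over_eq by auto
  have "bij_betw fst (X i j) (path_image (\<alpha>s ! i) \<inter> path_image (\<alpha>s ! j))"
    unfolding bij_betw_def
  proof
    show "inj_on fst (X i j)"
      using simple[THEN inj_on_fst_arc_lift] by (force simp: inj_on_def X_def crossing_pairs_def)
    show "fst ` X i j = path_image (\<alpha>s ! i) \<inter> path_image (\<alpha>s ! j)"
      using ov by (force simp: path X_def crossing_pairs_def)
  qed
  then show "finite (X i j)" "card (X i j) = card (path_image (\<alpha>s ! i) \<inter> path_image (\<alpha>s ! j))"
    using fin bij_betw_finite bij_betw_same_card by blast+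
  have inj: "inj_on fst (over m)" using m by (simp add: presents_def)
  show "X j i = {}"
  proof (rule ccontr)
    assume "X j i \<noteq> {}"
    then obtain p v w where pvw: "(p, v) \<in> over m" "(p, v) \<in> arc_lift (\<alpha>s ! j)"
        "(p, w) \<in> arc_lift (\<alpha>s ! i)"
      by (auto simp: X_def crossing_pairs_def)
    then have "(p, w) \<in> over m" using ov by blast
    then have "(p, v) = (p, w)" using inj_onD[OF inj, of "(p, v)" "(p, w)"] pvw by simp
    then show False using arc_diagram_disjoint[OF m ij] pvw by auto
  qed
qed

lemma crossing_pairs_singular:
  assumes "presents cs m" "fst ` A \<inter> fst ` B \<subseteq> singular m"
  shows "crossing_pairs (over m) A B = {}"
proof (rule ccontr)
  assume "crossing_pairs (over m) A B \<noteq> {}"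
  then obtain p v w where "(p, v) \<in> over m" "(p, v) \<in> A" "(p, w) \<in> B"
    by (auto simp: crossing_pairs_def)
  then have "p \<in> fst ` over m" "p \<in> singular m" using assms(2) by force+
  then show False using assms(1) by (auto simp: presents_def)
qed

text \<open>
  The count depends only on the levels top, middle and bottom, which a slide does not change.
\<close>

lemma III_side_crossings:
  assumes "triangle \<alpha> \<beta> \<gamma>" "III_side (\<alpha>, \<beta>, \<gamma>) m" "i < 3" "j < 3" "i \<noteq> j"
  defines "X \<equiv> crossing_pairs (over m) (arc_lift ([\<alpha>, \<beta>, \<gamma>] ! i)) (arc_lift ([\<alpha>, \<beta>, \<gamma>] ! j))"
  shows "finite X \<and> card X = (if i < j then 1 else 0)"
proof -
  have m: "presents (map Arc [\<alpha>, \<beta>, \<gamma>]) m" using assms by (simp add: III_side_def)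
  have sub: "tangents_over \<alpha> (path_image \<beta>) \<subseteq> over m" "tangents_over \<alpha> (path_image \<gamma>) \<subseteq> over m"
      "tangents_over \<beta> (path_image \<gamma>) \<subseteq> over m"
    using assms(2) by (auto simp: III_side_def tangents_over_eq)
  have fin: "finite (path_image \<alpha> \<inter> path_image \<beta>)" "finite (path_image \<alpha> \<inter> path_image \<gamma>)"
     "finite (path_image \<beta> \<inter> path_image \<gamma>)"
     "card (path_image \<alpha> \<inter> path_image \<beta>) = 1" "card (path_image \<alpha> \<inter> path_image \<gamma>) = 1"
     "card (path_image \<beta> \<inter> path_image \<gamma>) = 1"
    and simp: "simple \<alpha>" "simple \<beta>" "simple \<gamma>"
    using assms(1) by (auto simp: triangle_def is_singleton_altdef intro: card_ge_0_finite)
  note 01 = crossings_over[OF m, of 0 1, simplified, OF simp(1,2) fin(1) sub(1), unfolded fin]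
  note 02 = crossings_over[OF m, of 0 2, simplified, OF simp(1,3) fin(2) sub(2), unfolded fin]
  note 12 = crossings_over[OF m, of 1 2, simplified, OF simp(2,3) fin(3) sub(3), unfolded fin]
  have "i \<in> {0, 1, 2}" "j \<in> {0, 1, 2}" using assms by auto
  then show ?thesis using 01 02 12 \<open>i \<noteq> j\<close> by (elim insertE emptyE) (simp_all add: X_def)
qed

text \<open>
  The point that \<open>\<alpha>\<close> and \<open>\<beta>\<close> have in common is singular and does not count. What remains depends only on
  whether \<open>\<gamma>\<close> is above or below.
\<close>

lemma IV_side_crossings:
  assumes "triangle \<alpha> \<beta> \<gamma>" "IV_side atop (\<alpha>, \<beta>, \<gamma>) m" "i < 3" "j < 3" "i \<noteq> j"
  defines "X \<equiv> crossing_pairs (over m) (arc_lift ([\<alpha>, \<beta>, \<gamma>] ! i)) (arc_lift ([\<alpha>, \<beta>, \<gamma>] ! j))"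
  shows "finite X \<and> card X = (if (if atop then i = 2 else j = 2) then 1 else 0)"
proof -
  have m: "presents (map Arc [\<alpha>, \<beta>, \<gamma>]) m" using assms by (simp add: IV_side_def)
  have fin: "finite (path_image \<gamma> \<inter> path_image \<alpha>)" "finite (path_image \<gamma> \<inter> path_image \<beta>)"
     "finite (path_image \<alpha> \<inter> path_image \<gamma>)" "finite (path_image \<beta> \<inter> path_image \<gamma>)"
     "card (path_image \<gamma> \<inter> path_image \<alpha>) = 1" "card (path_image \<gamma> \<inter> path_image \<beta>) = 1"
     "card (path_image \<alpha> \<inter> path_image \<gamma>) = 1" "card (path_image \<beta> \<inter> path_image \<gamma>) = 1"
    and simp: "simple \<alpha>" "simple \<beta>" "simple \<gamma>"
    using assms(1) by (auto simp: triangle_def is_singleton_altdef Int_commute intro: card_ge_0_finite)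
  have sing: "path_image \<alpha> \<inter> path_image \<beta> \<subseteq> singular m" "path_image \<beta> \<inter> path_image \<alpha> \<subseteq> singular m"
    using assms(2) by (auto simp: IV_side_def)
  note 0 = sing[THEN crossing_pairs_singular[OF m, of "arc_lift _" "arc_lift _", unfolded fst_arc_lift]]
  have ij: "i \<in> {0, 1, 2}" "j \<in> {0, 1, 2}" using assms by auto
  show ?thesis
  proof (cases atop)
    case True
    then have sub: "tangents_over \<gamma> (path_image \<alpha>) \<subseteq> over m" "tangents_over \<gamma> (path_image \<beta>) \<subseteq> over m"
      using assms(2) by (auto simp: IV_side_def tangents_over_eq)
    note 20 = crossings_over[OF m, of 2 0, simplified, OF simp(3,1) fin(1) sub(1), unfolded fin]
    note 21 = crossings_over[OF m, of 2 1, simplified, OF simp(3,2) fin(2) sub(2), unfolded fin]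
    show ?thesis
      using ij 0 20 21 True \<open>i \<noteq> j\<close> by (elim insertE emptyE) (simp_all add: X_def)
  next
    case False
    then have sub: "tangents_over \<alpha> (path_image \<gamma>) \<subseteq> over m" "tangents_over \<beta> (path_image \<gamma>) \<subseteq> over m"
      using assms(2) by (auto simp: IV_side_def)
    note 02 = crossings_over[OF m, of 0 2, simplified, OF simp(1,3) fin(3) sub(1), unfolded fin]
    note 12 = crossings_over[OF m, of 1 2, simplified, OF simp(2,3) fin(4) sub(2), unfolded fin]
    show ?thesis
      using ij 0 02 12 False \<open>i \<noteq> j\<close> by (elim insertE emptyE) (simp_all add: X_def)
  qed
qed

lemma parity_equivalentI:
  assumes "presents (map Arc \<alpha>s) m" "presents (map Arc \<alpha>s') m'" "length \<alpha>s = n" "length \<alpha>s' = n"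
    and "\<And>i. i < n \<Longrightarrow> same_ends (\<alpha>s ! i) (\<alpha>s' ! i)"
    and "\<And>i j. i < n \<Longrightarrow> j < n \<Longrightarrow> i \<noteq> j \<Longrightarrow>
      finite (crossing_pairs (over m) (arc_lift (\<alpha>s ! i)) (arc_lift (\<alpha>s ! j))) \<and>
      card (crossing_pairs (over m) (arc_lift (\<alpha>s ! i)) (arc_lift (\<alpha>s ! j))) = N i j"
    and "\<And>i j. i < n \<Longrightarrow> j < n \<Longrightarrow> i \<noteq> j \<Longrightarrow>
      finite (crossing_pairs (over m') (arc_lift (\<alpha>s' ! i)) (arc_lift (\<alpha>s' ! j))) \<and>
      card (crossing_pairs (over m') (arc_lift (\<alpha>s' ! i)) (arc_lift (\<alpha>s' ! j))) = N' i j"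
    and "\<And>i j. odd (N i j) \<longleftrightarrow> odd (N' i j)"
  shows "parity_equivalent m m'"
  unfolding parity_equivalent_def using assms by (intro exI[of _ \<alpha>s] exI[of _ \<alpha>s']) simp

lemma move_I_parity_equivalent:
  assumes "(m, m') \<in> move_I"
  shows "parity_equivalent m m'"
proof -
  obtain \<alpha> \<alpha>' where "presents [Arc \<alpha>] m" "presents [Arc \<alpha>'] m'" "same_ends \<alpha> \<alpha>'"
    using assms unfolding move_I_def by blast
  then show ?thesis
    by (intro parity_equivalentI[where \<alpha>s = "[\<alpha>]" and \<alpha>s' = "[\<alpha>']" and n = 1
          and N = "\<lambda>_ _. 0" and N' = "\<lambda>_ _. 0"]) auto
qed

lemma move_II_parity_equivalent:
  assumes "(m, m') \<in> move_II"
  shows "parity_equivalent m m'"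
proof -
  obtain \<alpha> \<beta> \<alpha>' \<beta>' p q where II: "presents [Arc \<alpha>, Arc \<beta>] m" "presents [Arc \<alpha>', Arc \<beta>'] m'"
     "same_ends \<alpha> \<alpha>'" "same_ends \<beta> \<beta>'" "crossings m = {}"
     "simple \<alpha>'" "simple \<beta>'" "path_image \<alpha>' \<inter> path_image \<beta>' = {p, q}" "p \<noteq> q"
     "over m' = tangents_over \<alpha>' {p, q}"
    using assms unfolding move_II_def by blast
  have "fst ` over m = {}" using II(1,5) by (auto simp: presents_def)
  then have "over m = {}" by simp
  then have m: "crossing_pairs (over m) A B = {}" for A B by (simp add: crossing_pairs_def)
  have "tangents_over \<alpha>' (path_image \<beta>') \<subseteq> over m'"
    unfolding II(10) II(8)[symmetric] using fst_arc_lift[of \<alpha>'] by (auto simp: tangents_over_eq)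
  then have m': "finite (crossing_pairs (over m') (arc_lift \<alpha>') (arc_lift \<beta>'))"
      "card (crossing_pairs (over m') (arc_lift \<alpha>') (arc_lift \<beta>')) = 2"
      "crossing_pairs (over m') (arc_lift \<beta>') (arc_lift \<alpha>') = {}"
    using crossings_over[of "[\<alpha>', \<beta>']" m' 0 1] II by simp_all
  have less_2: "i = 0 \<or> i = 1" if "i < 2" for i :: nat using that by auto
  show ?thesis
  proof (rule parity_equivalentI[where \<alpha>s = "[\<alpha>, \<beta>]" and \<alpha>s' = "[\<alpha>', \<beta>']" and n = 2
          and N = "\<lambda>_ _. 0" and N' = "\<lambda>i j. if i = 0 then 2 else 0"])
    show "same_ends ([\<alpha>, \<beta>] ! i) ([\<alpha>', \<beta>'] ! i)" if "i < 2" for i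
      using less_2[OF that] II(3,4) by auto
    show "finite (crossing_pairs (over m') (arc_lift ([\<alpha>', \<beta>'] ! i)) (arc_lift ([\<alpha>', \<beta>'] ! j))) \<and>
        card (crossing_pairs (over m') (arc_lift ([\<alpha>', \<beta>'] ! i)) (arc_lift ([\<alpha>', \<beta>'] ! j)))
          = (if i = 0 then 2 else 0)" if "i < 2" "j < 2" "i \<noteq> j" for i j
      using less_2[OF that(1)] less_2[OF that(2)] \<open>i \<noteq> j\<close> m'
      by (elim disjE) simp_all
  qed (use II(1,2) m in simp_all)
qed

lemma move_III_parity_equivalent:
  assumes "(m, m') \<in> move_III"
  shows "parity_equivalent m m'"
proof -
  obtain \<alpha> \<beta> \<gamma> \<alpha>' \<beta>' \<gamma>' where III: "slid (\<alpha>, \<beta>, \<gamma>) (\<alpha>', \<beta>', \<gamma>')"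
      "III_side (\<alpha>, \<beta>, \<gamma>) m" "III_side (\<alpha>', \<beta>', \<gamma>') m'"
    using assms unfolding move_III_def by auto
  have tri: "triangle \<alpha> \<beta> \<gamma>" "triangle \<alpha>' \<beta>' \<gamma>'"
    and ends: "same_ends \<alpha> \<alpha>'" "same_ends \<beta> \<beta>'" "same_ends \<gamma> \<gamma>'"
    using III(1) by (auto simp: slid_def)
  show ?thesis
  proof (rule parity_equivalentI[OF _ _ _ _ _ III_side_crossings[OF tri(1) III(2)]
        III_side_crossings[OF tri(2) III(3)]])
    show "same_ends ([\<alpha>, \<beta>, \<gamma>] ! i) ([\<alpha>', \<beta>', \<gamma>'] ! i)" if "i < 3" for i
      using that ends by (auto simp: less_Suc_eq numeral_3_eq_3)
  qed (use III in \<open>auto simp: III_side_def\<close>)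
qed

lemma move_IV_parity_equivalent:
  assumes "(m, m') \<in> move_IV"
  shows "parity_equivalent m m'"
proof -
  obtain \<alpha> \<beta> \<gamma> \<alpha>' \<beta>' \<gamma>' atop where IV: "slid (\<alpha>, \<beta>, \<gamma>) (\<alpha>', \<beta>', \<gamma>')"
      "IV_side atop (\<alpha>, \<beta>, \<gamma>) m" "IV_side atop (\<alpha>', \<beta>', \<gamma>') m'"
    using assms unfolding move_IV_def by auto
  have tri: "triangle \<alpha> \<beta> \<gamma>" "triangle \<alpha>' \<beta>' \<gamma>'"
    and ends: "same_ends \<alpha> \<alpha>'" "same_ends \<beta> \<beta>'" "same_ends \<gamma> \<gamma>'"
    using IV(1) by (auto simp: slid_def)
  show ?thesis
  proof (rule parity_equivalentI[OF _ _ _ _ _ IV_side_crossings[OF tri(1) IV(2)]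
        IV_side_crossings[OF tri(2) IV(3)]])
    show "same_ends ([\<alpha>, \<beta>, \<gamma>] ! i) ([\<alpha>', \<beta>', \<gamma>'] ! i)" if "i < 3" for i
      using that ends by (auto simp: less_Suc_eq numeral_3_eq_3)
  qed (use IV in \<open>auto simp: IV_side_def\<close>)
qed

section \<open>A move of type V that changes the invariant\<close>

text \<open>
  The diameter of the disk on the real axis, and the parabola \<open>y = 5/2 x\<^sup>2 - 1/10\<close> for \<open>-3/5 \<le> x \<le> 3/5\<close>.
  The coefficients are chosen such that the parabola meets the unit circle in the rational points
  \<open>(\<plusminus>3/5, 4/5)\<close> and the diameter in the points \<open>(\<plusminus>1/5, 0)\<close>.
\<close>

definition line_arc :: "real \<Rightarrow> complex" where
  "line_arc t = Complex (2 * t - 1) 0"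

definition parabola_arc :: "real \<Rightarrow> complex" where
  "parabola_arc t = (let x = (6 * t - 3) / 5 in Complex x (5 / 2 * x\<^sup>2 - 1 / 10))"

lemma line_arc_derivative: "(line_arc has_vector_derivative 2) (at t)"
  unfolding line_arc_def has_vector_derivative_complex_iff
  by (auto intro!: derivative_eq_intros)

lemma parabola_arc_derivative:
  "(parabola_arc has_vector_derivative Complex (6 / 5) (6 * ((6 * t - 3) / 5))) (at t)"
  unfolding parabola_arc_def Let_def has_vector_derivative_complex_iff
  by (auto intro!: derivative_eq_intros simp: field_simps power2_eq_square)

lemmas example_derivatives =
  vector_derivative_at[OF line_arc_derivative] vector_derivative_at[OF parabola_arc_derivative]

lemma simple_line_arc: "simple line_arc"
  by (auto simp: inj_on_def line_arc_def)

lemma simple_parabola_arc: "simple parabola_arc"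
  by (auto simp: inj_on_def parabola_arc_def Let_def)

lemma proper_line_arc: "proper_strand (Arc line_arc)"
proof -
  have "line_arc C1_differentiable_on {0..1}"
    unfolding C1_differentiable_on_def using line_arc_derivative
    by (intro exI[of _ "\<lambda>_. 2"]) auto
  moreover have "line_arc t \<in> ball 0 1" if "t \<in> {0<..<1}" for t
    using that by (auto simp: line_arc_def complex_norm abs_if)
  ultimately show ?thesis
    by (auto simp: example_derivatives line_arc_def complex_norm inner_complex_def)
qed

lemma proper_parabola_arc: "proper_strand (Arc parabola_arc)"
proof -
  have "continuous_on {0..1} (\<lambda>t. Complex (6 / 5) (6 * ((6 * t - 3) / 5)))"
    unfolding Complex_eq by (intro continuous_intros) simp_all
  then have "parabola_arc C1_differentiable_on {0..1}"
    unfolding C1_differentiable_on_def using parabola_arc_derivative by (intro exI conjI ballI)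
  moreover have "parabola_arc t \<in> ball 0 1" if "t \<in> {0<..<1}" for t
  proof -
    define x where "x = (6 * t - 3) / 5"
    define y where "y = 5 / 2 * x\<^sup>2 - 1 / 10"
    have "- (3 / 5) < x" "x < 3 / 5" using that by (simp_all add: x_def)
    then have "\<bar>x\<bar> < 3 / 5" by (simp add: abs_less_iff)
    then have "\<bar>x\<bar>\<^sup>2 < (3 / 5)\<^sup>2" by (intro power_strict_mono) simp_all
    then have x2: "x\<^sup>2 < (3 / 5)\<^sup>2" by simp
    then have "x\<^sup>2 < 9 / 25" by (simp add: power_divide)
    moreover have "x\<^sup>2 \<ge> 0" by simp
    ultimately have "y < 4 / 5" "- y < 4 / 5" unfolding y_def by linarith+
    then have "\<bar>y\<bar> < 4 / 5" by (simp add: abs_less_iff)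
    then have "\<bar>y\<bar>\<^sup>2 < (4 / 5)\<^sup>2" by (intro power_strict_mono) simp_all
    then have "y\<^sup>2 < (4 / 5)\<^sup>2" by simp
    with x2 have "x\<^sup>2 + y\<^sup>2 < (3 / 5)\<^sup>2 + (4 / 5)\<^sup>2" by (rule add_strict_mono)
    also have "(3 / 5)\<^sup>2 + (4 / 5)\<^sup>2 = (1 :: real)" by (simp add: power2_eq_square)
    finally have "norm (Complex x y) < 1" by (simp add: complex_norm)
    moreover have "parabola_arc t = Complex x y" by (simp only: parabola_arc_def Let_def x_def y_def)
    ultimately show ?thesis by simp
  qed
  moreover have "parabola_arc 0 = Complex (- 3 / 5) (4 / 5)" "parabola_arc 1 = Complex (3 / 5) (4 / 5)"
    by (simp_all add: parabola_arc_def Let_def power2_eq_square)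
  moreover have "Complex (6 / 5) y \<noteq> 0" for y by (simp add: complex_eq_iff)
  ultimately show ?thesis
    by (auto simp: example_derivatives complex_norm inner_complex_def power2_eq_square)
qed

text \<open>
  At a common point, the parabola has the abscissa \<open>x\<close> with \<open>x\<^sup>2 = 1/25\<close>.
\<close>

lemma line_meets_parabola:
  assumes "line_arc s = parabola_arc t"
  shows "s = 2 / 5 \<and> t = 1 / 3 \<or> s = 3 / 5 \<and> t = 2 / 3"
proof -
  define x where "x = (6 * t - 3) / 5"
  have x: "2 * s - 1 = x" "5 / 2 * x\<^sup>2 - 1 / 10 = 0"
    using assms by (auto simp: line_arc_def parabola_arc_def Let_def x_def)
  have "(x - 1 / 5) * (x + 1 / 5) = 0" using x(2) by (simp add: power2_eq_square algebra_simps)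
  then have "x = 1 / 5 \<or> x = - 1 / 5" by auto
  then show ?thesis using x(1) by (auto simp: x_def)
qed

definition left_pt :: complex where "left_pt = Complex (- 1 / 5) 0"
definition right_pt :: complex where "right_pt = Complex (1 / 5) 0"

lemma crossing_points:
  "line_arc (2 / 5) = left_pt" "line_arc (3 / 5) = right_pt"
  "parabola_arc (1 / 3) = left_pt" "parabola_arc (2 / 3) = right_pt"
  by (simp_all add: line_arc_def parabola_arc_def Let_def left_pt_def right_pt_def power2_eq_square)

lemma left_neq_right: "left_pt \<noteq> right_pt"
  by (simp add: left_pt_def right_pt_def)

lemma path_images_meet: "path_image line_arc \<inter> path_image parabola_arc = {left_pt, right_pt}"
proof
  show "path_image line_arc \<inter> path_image parabola_arc \<subseteq> {left_pt, right_pt}"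
  proof
    fix q assume "q \<in> path_image line_arc \<inter> path_image parabola_arc"
    then obtain s t where "q = line_arc s" "q = parabola_arc t" unfolding path_image_def by blast
    then show "q \<in> {left_pt, right_pt}"
      using line_meets_parabola[of s t] crossing_points by (metis insertCI)
  qed
  have "2 / 5 \<in> {0..1::real}" "3 / 5 \<in> {0..1::real}" "1 / 3 \<in> {0..1::real}" "2 / 3 \<in> {0..1::real}" by auto
  then show "{left_pt, right_pt} \<subseteq> path_image line_arc \<inter> path_image parabola_arc"
    unfolding path_image_def using crossing_points by (metis IntI empty_subsetI imageI insert_subset)
qed

text \<open>
  The unit tangent vector of the parabola above \<open>x\<close>, where the derivative of \<open>y\<close> is \<open>5 x\<close>.
\<close>

definition slope :: "real \<Rightarrow> complex" where
  "slope x = sgn (Complex 1 (5 * x))"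

lemma sgn_two: "sgn (2 :: complex) = 1"
  by (simp add: sgn_eq)

lemma arc_lift_line: "arc_lift line_arc = (\<lambda>t. (line_arc t, 1)) ` {0..1}"
  by (simp add: strand_lift_def example_derivatives sgn_two)

lemma arc_lift_parabola: "arc_lift parabola_arc = (\<lambda>t. (parabola_arc t, slope ((6 * t - 3) / 5))) ` {0..1}"
proof -
  have "sgn (Complex (6 / 5) (6 * x)) = slope x" for x :: real
  proof -
    have "Complex (6 / 5) (6 * x) = (6 / 5) *\<^sub>R Complex 1 (5 * x)" by (simp add: complex_eq_iff)
    then show ?thesis by (simp only: slope_def sgn_scaleR) simp
  qed
  then show ?thesis
    by (simp only: strand_lift_def example_derivatives strand.sel strand_dom.simps)
qed

lemma wedge_slope:
  "wedge 1 (slope x) = 5 * x / norm (Complex 1 (5 * x))"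
  "wedge (slope x) 1 = - 5 * x / norm (Complex 1 (5 * x))"
  "norm (Complex 1 (5 * x)) > 0"
  by (simp_all add: wedge_def slope_def sgn_div_norm complex_eq_iff divide_inverse mult.commute)

lemma generic_example: "generic_immersion [Arc line_arc, Arc parabola_arc]"
proof -
  let ?cs = "[Arc line_arc, Arc parabola_arc]"
  have params: "x \<in> params ?cs \<longleftrightarrow> (fst x = 0 \<or> fst x = 1) \<and> snd x \<in> {0..1}" for x
    by (cases x) (auto simp: params_def less_Suc_eq)
  have pos: "pos ?cs (0, s) = line_arc s" "pos ?cs (1, s) = parabola_arc s" for s
    by (simp_all add: pos_def)
  have dir: "dir ?cs (0, s) = 1" "dir ?cs (1, s) = slope ((6 * s - 3) / 5)" if "s \<in> {0..1}" for s
  proof -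
    have "vector_derivative line_arc (at s) = 2" by (rule example_derivatives)
    then show "dir ?cs (0, s) = 1" by (simp add: dir_def sgn_two)
    have "Complex (6 / 5) (6 * ((6 * s - 3) / 5)) = (6 / 5) *\<^sub>R Complex 1 (5 * ((6 * s - 3) / 5))"
      by (simp add: complex_eq_iff)
    then show "dir ?cs (1, s) = slope ((6 * s - 3) / 5)"
      by (simp only: dir_def fst_conv snd_conv slope_def) (simp add: example_derivatives sgn_scaleR)
  qed
  have inj0: "s = t" if "line_arc s = line_arc t" "s \<in> {0..1}" "t \<in> {0..1}" for s t
    using simple_line_arc that by (auto dest: inj_onD)
  have inj1: "s = t" if "parabola_arc s = parabola_arc t" "s \<in> {0..1}" "t \<in> {0..1}" for s t
    using simple_parabola_arc that by (auto dest: inj_onD)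
  have key: "line_arc s \<in> ball 0 1 \<and> wedge 1 (slope ((6 * t - 3) / 5)) \<noteq> 0
      \<and> wedge (slope ((6 * t - 3) / 5)) 1 \<noteq> 0" if "line_arc s = parabola_arc t" for s t
  proof -
    have "line_arc s \<in> ball 0 1" "(6 * t - 3) / 5 \<noteq> 0"
      using line_meets_parabola[OF that] by (auto simp: line_arc_def complex_norm)
    then show ?thesis using wedge_slope[of "(6 * t - 3) / 5"] by simp
  qed
  show ?thesis
    unfolding generic_immersion_def
  proof (intro conjI ballI impI)
    show "proper_strand c" if "c \<in> set ?cs" for c
      using that proper_line_arc proper_parabola_arc by auto
  next
    fix x y assume x: "x \<in> params ?cs" and y: "y \<in> params ?cs" and xy: "x \<noteq> y \<and> pos ?cs x = pos ?cs y"
    obtain s t where st: "s \<in> {0..1}" "t \<in> {0..1}" "line_arc s = parabola_arc t"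
      "x = (0, s) \<and> y = (1, t) \<or> x = (1, t) \<and> y = (0, s)"
    proof -
      obtain i s j t where ij: "x = (i, s)" "y = (j, t)" by (metis surj_pair)
      have "i = 0 \<or> i = 1" "j = 0 \<or> j = 1" "s \<in> {0..1}" "t \<in> {0..1}"
        using x y ij unfolding params by auto
      then show ?thesis using that xy inj0 inj1 unfolding ij by (elim disjE) (simp_all only: pos, metis+)
    qed
    show "pos ?cs x \<in> ball 0 1" "wedge (dir ?cs x) (dir ?cs y) \<noteq> 0"
      using st(4) key[OF st(3)] st(3) pos dir[OF st(1)] dir[OF st(2)] by (elim disjE conjE; simp only:)+
    fix z assume z: "z \<in> params ?cs" "pos ?cs z = pos ?cs x"
    obtain k u where k: "z = (k, u)" "k = 0 \<or> k = 1" "u \<in> {0..1}"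
      using z(1) unfolding params by (metis prod.collapse)
    have "pos ?cs z = line_arc s" using z(2) st(3,4) pos by metis
    then have "z = (0, s) \<or> z = (1, t)"
      using k pos inj0 inj1 st(1-3) by metis
    then show "z = x \<or> z = y" using st(4) by blast
  qed
qed

text \<open>
  The singular crossing is \<open>p\<close>, and \<open>x\<close> is the over strand at the other crossing.
\<close>

definition example_diagram :: "complex \<Rightarrow> complex \<times> complex \<Rightarrow> diagram" where
  "example_diagram p x = \<lparr>tangents = unit_tangents [Arc line_arc, Arc parabola_arc],
     singular = {p}, over = {x}\<rparr>"

lemma example_tangents: "tangents (example_diagram p x) = arc_lift line_arc \<union> arc_lift parabola_arc"
  by (auto simp: example_diagram_def unit_tangents_eq less_Suc_eq)

lemma example_lifts:
  "(left_pt, 1) \<in> arc_lift line_arc" "(right_pt, 1) \<in> arc_lift line_arc"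
  "(left_pt, slope (- 1 / 5)) \<in> arc_lift parabola_arc" "(right_pt, slope (1 / 5)) \<in> arc_lift parabola_arc"
proof -
  show "(left_pt, 1) \<in> arc_lift line_arc" "(right_pt, 1) \<in> arc_lift line_arc"
    unfolding arc_lift_line
    by (rule image_eqI[of _ _ "2 / 5"], simp_all add: crossing_points)
      (rule image_eqI[of _ _ "3 / 5"], simp_all add: crossing_points)
  show "(left_pt, slope (- 1 / 5)) \<in> arc_lift parabola_arc"
    "(right_pt, slope (1 / 5)) \<in> arc_lift parabola_arc"
    unfolding arc_lift_parabola
    by (rule image_eqI[of _ _ "1 / 3"], simp_all add: crossing_points)
      (rule image_eqI[of _ _ "2 / 3"], simp_all add: crossing_points)
qed

lemma slope_neq_1: "x \<noteq> 0 \<Longrightarrow> slope x \<noteq> 1"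
  using wedge_slope(1,3)[of x] by (auto simp: wedge_def)

lemma example_crossings: "crossings (example_diagram p x) = {left_pt, right_pt}"
proof
  show "{left_pt, right_pt} \<subseteq> crossings (example_diagram p x)"
    using example_lifts slope_neq_1[of "1 / 5"] slope_neq_1[of "- 1 / 5"]
    unfolding crossings_def example_tangents by fastforce
  show "crossings (example_diagram p x) \<subseteq> {left_pt, right_pt}"
  proof
    fix q assume "q \<in> crossings (example_diagram p x)"
    then obtain v w where vw: "v \<noteq> w" "(q, v) \<in> arc_lift line_arc \<union> arc_lift parabola_arc"
        "(q, w) \<in> arc_lift line_arc \<union> arc_lift parabola_arc"
      unfolding crossings_def example_tangents by blast
    have "v = w" if "(q, v) \<in> arc_lift \<alpha>" "(q, w) \<in> arc_lift \<alpha>" "simple \<alpha>" for \<alpha>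
      using that by (auto simp: strand_lift_def dest: inj_onD)
    then have "q \<in> fst ` arc_lift line_arc \<inter> fst ` arc_lift parabola_arc"
      using vw simple_line_arc simple_parabola_arc by force
    then show "q \<in> {left_pt, right_pt}" by (simp add: fst_arc_lift path_images_meet)
  qed
qed

lemma example_V_side:
  assumes "p \<noteq> q" "{p, q} = {left_pt, right_pt}" "fst x = q" "x \<in> arc_lift line_arc \<union> arc_lift parabola_arc"
  shows "V_side line_arc parabola_arc p q (example_diagram p x)"
proof -
  have simps: "singular (example_diagram p x) = {p}" "over (example_diagram p x) = {x}"
    "tangents (example_diagram p x) = unit_tangents [Arc line_arc, Arc parabola_arc]"
    by (simp_all add: example_diagram_def)
  have "{x} \<subseteq> unit_tangents [Arc line_arc, Arc parabola_arc]"
    using assms(4) unfolding simps(3)[symmetric] example_tangents by simp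
  moreover have "{p} \<subseteq> {left_pt, right_pt}" "fst ` {x} = {left_pt, right_pt} - {p}"
    using assms(1,3) unfolding assms(2)[symmetric] by auto
  ultimately have "presents [Arc line_arc, Arc parabola_arc] (example_diagram p x)"
    unfolding presents_def example_crossings simps using generic_example by simp
  then show ?thesis
    using assms simple_line_arc simple_parabola_arc path_images_meet
    by (simp add: V_side_def example_diagram_def)
qed

text \<open>
  The diagrams are named after the position of the singular crossing. The underlying curves are the same.
  At the right crossing the parabola passes the line from right to left, and at the left crossing from
  left to right; hence both real crossings are positive if the line is above at the right one and the
  parabola at the left one.
\<close>

definition V_left :: diagram where "V_left = example_diagram left_pt (right_pt, 1)"
definition V_right :: diagram where "V_right = example_diagram right_pt (left_pt, slope (- 1 / 5))"

text \<open>
  Both sides of the move have the same arcs, only the two crossings exchange their kinds. Therefore each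
  arc meets the two kinds of crossings in the opposite order.
\<close>

lemma V_example: "(V_left, V_right) \<in> move_V"
proof -
  have "V_side line_arc parabola_arc left_pt right_pt V_left"
       "V_side line_arc parabola_arc right_pt left_pt V_right"
    unfolding V_left_def V_right_def using example_lifts left_neq_right
    by (intro example_V_side; simp add: insert_commute)+
  moreover have "positive_crossing V_left right_pt"
  proof -
    have "(right_pt, slope (1 / 5)) \<in> tangents V_left - over V_left"
      using example_lifts slope_neq_1[of "1 / 5"] unfolding V_left_def example_tangents
      by (simp add: example_diagram_def)
    moreover have "(right_pt, 1) \<in> over V_left" by (simp add: V_left_def example_diagram_def)
    moreover have "wedge 1 (slope (1 / 5)) > 0" using wedge_slope[of "1 / 5"] by simp
    ultimately show ?thesis unfolding positive_crossing_def by blast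
  qed
  moreover have "positive_crossing V_right left_pt"
  proof -
    have "(left_pt, 1) \<in> tangents V_right - over V_right"
      using example_lifts slope_neq_1[of "- 1 / 5"] unfolding V_right_def example_tangents
      by (simp add: example_diagram_def)
    moreover have "(left_pt, slope (- 1 / 5)) \<in> over V_right" by (simp add: V_right_def example_diagram_def)
    moreover have "wedge (slope (- 1 / 5)) 1 > 0" using wedge_slope[of "- 1 / 5"] by simp
    ultimately show ?thesis unfolding positive_crossing_def by blast
  qed
  ultimately have "\<exists>\<alpha> \<beta> p q \<alpha>' \<beta>' p' q'.
     V_side \<alpha> \<beta> p q V_left \<and> V_side \<alpha>' \<beta>' p' q' V_right \<and>
     same_ends \<alpha> \<alpha>' \<and> same_ends \<beta> \<beta>' \<and>
     (before \<alpha> {p} {q} \<longleftrightarrow> before \<alpha>' {q'} {p'}) \<and>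
     (before \<beta> {p} {q} \<longleftrightarrow> before \<beta>' {q'} {p'}) \<and>
     (positive_crossing V_left q \<longleftrightarrow> positive_crossing V_right q')"
    by (intro exI[of _ line_arc] exI[of _ parabola_arc] exI[of _ left_pt] exI[of _ right_pt])
      (simp add: same_ends_def)
  then show ?thesis by (simp add: move_V_def)
qed

lemma lifts_disjoint: "arc_lift line_arc \<inter> arc_lift parabola_arc = {}"
proof -
  have "V_side line_arc parabola_arc left_pt right_pt V_left"
    unfolding V_left_def using example_lifts left_neq_right by (intro example_V_side) simp_all
  then have "presents (map Arc [line_arc, parabola_arc]) V_left" by (simp add: V_side_def)
  from arc_diagram_disjoint[OF this, of 0 1] show ?thesis by simp
qed

lemma crossing_pairs_single:
  assumes "(p, v) \<in> A"
  shows "crossing_pairs {(p, v)} A B = (\<lambda>w. (p, v, w)) ` {w. (p, w) \<in> B}"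
  using assms by (auto simp: crossing_pairs_def)

lemma odd_splitting_V_left: "odd_splitting (- 1) (Complex (- 3 / 5) (4 / 5)) V_left"
proof -
  have "crossing_pairs (over V_left) (arc_lift line_arc) (arc_lift parabola_arc)
      = {(right_pt, 1, slope (1 / 5))}"
  proof -
    have "{w. (right_pt, w) \<in> arc_lift parabola_arc} = {slope (1 / 5)}"
    proof
      show "{slope (1 / 5)} \<subseteq> {w. (right_pt, w) \<in> arc_lift parabola_arc}"
        using example_lifts(4) by simp
      show "{w. (right_pt, w) \<in> arc_lift parabola_arc} \<subseteq> {slope (1 / 5)}"
      proof
        fix w assume "w \<in> {w. (right_pt, w) \<in> arc_lift parabola_arc}"
        then have "(right_pt, w) = (right_pt, slope (1 / 5))"
          by (intro inj_onD[OF inj_on_fst_arc_lift[OF simple_parabola_arc] _ _ example_lifts(4)]) simp_all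
        then show "w \<in> {slope (1 / 5)}" by simp
      qed
    qed
    moreover have "over V_left = {(right_pt, 1)}" by (simp add: V_left_def example_diagram_def)
    ultimately show ?thesis
      by (simp only: crossing_pairs_single[OF example_lifts(2)] image_insert image_empty)
  qed
  then have "odd (card (crossing_pairs (over V_left) (arc_lift line_arc) (arc_lift parabola_arc)))" by simp
  moreover have "closed (arc_lift line_arc)" "closed (arc_lift parabola_arc)"
    using compact_strand_lift proper_line_arc proper_parabola_arc compact_imp_closed by blast+
  moreover have "tangents V_left = arc_lift line_arc \<union> arc_lift parabola_arc"
    unfolding V_left_def by (rule example_tangents)
  moreover have "\<forall>x\<in>arc_lift parabola_arc. fst x \<noteq> - 1"
    by (auto simp: arc_lift_parabola parabola_arc_def Let_def complex_eq_iff)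
  moreover have "\<forall>x\<in>arc_lift line_arc. fst x \<noteq> Complex (- 3 / 5) (4 / 5)"
    by (auto simp: arc_lift_line line_arc_def)
  ultimately show ?thesis unfolding odd_splitting_def
    using lifts_disjoint by (intro exI[of _ "arc_lift line_arc"] exI[of _ "arc_lift parabola_arc"] conjI)
qed

text \<open>
  The parabola is connected and starts at the boundary point excluded from \<open>A\<close>, so that all of it has the
  colour \<open>B\<close>; but it is the upper strand at the only real crossing.
\<close>

lemma not_odd_splitting_V_right: "\<not> odd_splitting (- 1) (Complex (- 3 / 5) (4 / 5)) V_right"
proof
  assume "odd_splitting (- 1) (Complex (- 3 / 5) (4 / 5)) V_right"
  then obtain A B where AB: "closed A" "closed B" "A \<inter> B = {}" "tangents V_right = A \<union> B"
     "\<forall>x\<in>B. fst x \<noteq> - 1" "\<forall>x\<in>A. fst x \<noteq> Complex (- 3 / 5) (4 / 5)"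
     "odd (card (crossing_pairs (over V_right) A B))"
    unfolding odd_splitting_def by (elim exE conjE) (rule that)
  have T: "A \<union> B = arc_lift line_arc \<union> arc_lift parabola_arc"
    using AB(4) unfolding V_right_def example_tangents by simp
  have conn: "connected (arc_lift parabola_arc)"
    using compact_connected_arc_lift(2) proper_parabola_arc .
  have "(Complex (- 3 / 5) (4 / 5), slope (- 3 / 5)) \<in> arc_lift parabola_arc"
    unfolding arc_lift_parabola
    by (rule image_eqI[of _ _ 0]) (simp_all add: parabola_arc_def Let_def power2_eq_square)
  moreover from this have "(Complex (- 3 / 5) (4 / 5), slope (- 3 / 5)) \<in> B"
    using T AB(6) by force
  ultimately have "arc_lift parabola_arc \<inter> B \<noteq> {}" by blast
  moreover have "arc_lift parabola_arc \<subseteq> A \<union> B" "A \<inter> B \<inter> arc_lift parabola_arc = {}"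
    using T AB(3) by auto
  ultimately have "A \<inter> arc_lift parabola_arc = {}"
    using conn AB(1,2) unfolding connected_closed by blast
  then have "(left_pt, slope (- 1 / 5)) \<notin> A" using example_lifts(3) by blast
  then have "crossing_pairs (over V_right) A B = {}"
    by (auto simp: crossing_pairs_def V_right_def example_diagram_def)
  then show False using AB(7) by simp
qed

section \<open>Invariance and conclusion\<close>

lemma generating_moves_parity_equivalent:
  assumes "(m, m') \<in> classical_moves \<union> move_IV"
  shows "parity_equivalent m m'"
  using assms move_I_parity_equivalent move_II_parity_equivalent move_III_parity_equivalent
    move_IV_parity_equivalent
  unfolding classical_moves_def by blast

lemma odd_splitting_apply_move:
  assumes "parity_equivalent (fst m) (snd m)" "apply_move m d d' \<or> apply_move m d' d"
    and "a \<in> sphere 0 1" "b \<in> sphere 0 1" "odd_splitting a b d"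
  shows "odd_splitting a b d'"
  using assms(2)
proof
  assume "apply_move m d d'"
  then obtain e e' where "is_diagram d" "is_diagram d'" "disk_embedding e e'"
      "restrict_diagram d (e ` cball 0 1) = push e e' (fst m)"
      "restrict_diagram d' (e ` cball 0 1) = push e e' (snd m)"
      "restrict_diagram d (- (e ` cball 0 1)) = restrict_diagram d' (- (e ` cball 0 1))"
    unfolding apply_move_def by blast
  then show ?thesis
    using odd_splitting_replace_disk[OF assms(1)] assms(3-5) by blast
next
  assume "apply_move m d' d"
  then obtain e e' where "is_diagram d'" "is_diagram d" "disk_embedding e e'"
      "restrict_diagram d' (e ` cball 0 1) = push e e' (fst m)"
      "restrict_diagram d (e ` cball 0 1) = push e e' (snd m)"
      "restrict_diagram d (- (e ` cball 0 1)) = restrict_diagram d' (- (e ` cball 0 1))"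
    unfolding apply_move_def by metis
  then show ?thesis
    using odd_splitting_replace_disk[OF parity_equivalent_sym[OF assms(1)]] assms(3-5) by blast
qed

lemma odd_splitting_elementary_change:
  assumes "elementary_change (classical_moves \<union> move_IV) d d'"
    and ab: "a \<in> sphere 0 1" "b \<in> sphere 0 1" and odd: "odd_splitting a b d"
  shows "odd_splitting a b d'"
proof (cases "planar_isotopic d d'")
  case True
  then show ?thesis using ab odd by (rule odd_splitting_planar_isotopic)
next
  case False
  then obtain m where m: "m \<in> classical_moves \<union> move_IV" "apply_move m d d' \<or> apply_move m d' d"
    using assms(1) unfolding elementary_change_def by blast
  have "parity_equivalent (fst m) (snd m)"
    using m(1) by (intro generating_moves_parity_equivalent) simp
  then show ?thesis using m(2) ab odd by (rule odd_splitting_apply_move)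
qed

theorem proposition3p5:
  shows "\<not> generates (classical_moves \<union> move_IV) move_V"
proof
  let ?S = "classical_moves \<union> move_IV"
  let ?a = "- 1 :: complex" and ?b = "Complex (- 3 / 5) (4 / 5)"
  assume "generates ?S move_V"
  then have "(elementary_change ?S)\<^sup>*\<^sup>* V_left V_right"
    using V_example by (force simp: generates_def generated_by_def)
  moreover have ends: "?a \<in> sphere 0 1" "?b \<in> sphere 0 1"
    by (simp_all add: complex_norm power2_eq_square)
  ultimately have "odd_splitting ?a ?b V_right"
  proof (induction rule: rtranclp_induct)
    case base
    show ?case by (rule odd_splitting_V_left)
  next
    case (step d d')
    show ?case using step.hyps(2) ends step.IH[OF ends] by (rule odd_splitting_elementary_change)
  qed
  then show False using not_odd_splitting_V_right by blast
qed

end
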